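(* Let $k$ be a field of characteristic $0$ and let $(V,Q,\Delta,\cdot)$ be a differential BV algebra over $k$. Let $K:=Q+\hbar\Delta$ on $V[[\hbar]]$ and let $L_\hbar:=(V[[\hbar]],K,[\,,\,])$ be the associated quantum dgLa. Then $L_\hbar$ is smooth formal as a quantum dgLa if and only if the spectral sequence associated to the decreasing filtration $F^p=\hbar^pV[[\hbar]]$ ($p\ge 0$) of the complex $(V[[\hbar]],K)$ degenerates at the $E_1$ term.
   Context: **BV algebra.** A BV algebra is a triple $(V,\Delta,\cdot)$ where $(V,\cdot)$ is a $\mathbb{Z}$-graded, (graded-)commutative, associative, unital $k$-algebra, and $\Delta:V^j\to V^{j-1}$ is linear with $\Delta^2=0$ such that for each $v\in V^j$ the operator $d_v(w)=\Delta(v w)-\Delta(v) w-(-1)^{j}v\Delta(w)$ is a derivation of degree $j-1$ of the product. **Differential BV algebra.** A quadruple $(V,Q,\Delta,\cdot)$ where $(V,Q,\cdot)$ is a differential graded, commutative, associative, unital algebra with $Q$ of degree $+1$ (so $Q^2=0$ and $Q$ is a derivation of the product), $(V,\Delta,\cdot)$ is a BV algebra, and $Q\Delta+\Delta Q=0$. The bracket is $[v,w]:=\Delta(vw)-\Delta(v)w-(-1)^{|v|}v\Delta(w)$. **Quantum dgLa.** $L_\hbar=(V[[\hbar]],K,[\,,\,])$ with $K=Q+\hbar\Delta$, where $\hbar$ is a formal variable (of degree $+2$) and $Q,\Delta$, the product and the bracket are extended $k[[\hbar]]$-linearly. **Smooth formal as a quantum dgLa.** Let $H:=\ker(Q)/\operatorname{im}(Q)$,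 the homology of $(V,Q)$. Choose a homogeneous basis of $H$ indexed by $i\in I$, and let $t^i$ be the dual coordinates: graded-commuting formal variables, $t^i$ having the same parity as the $i$-th basis class. Let $V[[\hbar]][[t]]$ denote formal power series in the $t^i$ with coefficients in $V[[\hbar]]$ (one coefficient for each monomial in finitely many of the variables), with product following the Koszul sign rule and $Q,\Delta,K$ acting on coefficients, e.g. $\Delta(v\,t^{i_1}\cdots t^{i_n})=\Delta(v)t^{i_1}\cdots t^{i_n}$; the bracket is extended by the same formula in terms of $\Delta$ and the product. $L_\hbar$ is *smooth formal as a quantum dgLa* if there exists a versal solution to the quantum master equation, i.e. (for some choice of homogeneous basis of $H$) an even element (degree zero for the $\mathbb{Z}/2$-grading) $$\Gamma=\sum\gamma_it^i+\sum\gamma_{ij}t^it^j+\sum\gamma_{ijk}t^it^jt^k+\cdots\in V[[\hbar]][[t]]$$ with no constant term in $t$, satisfying $$K\Gamma+\tfrac12[\Gamma,\Gamma]=0,$$ where, writing $\gamma_{i}=\gamma_{i}^{(0)}+\gamma_{i}^{(1)}\hbar+\gamma_i^{(2)}\hbar^2+\cdots$ with $\gamma_i^{(j)}\in V$, each $\gamma_i^{(0)}$ is a $Q$-closed homogeneous representative of the $i$-th basis class of $H$ (the class dual to $t^i$). **Degeneration.** Let $(E_r^p,d_r)$ be the spectral sequence of the filtered complex $(V[[\hbar]],K)$ with $F^p=\hbar^pV[[\hbar]]$; $K$ acts on $E_0^0=F^0/F^1\cong V$ by $Q$, so $E_1^0=H(V,Q)$. It degenerates at the $E_1$ term if $d_r=0$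 for all $r\ge 1$. Equivalently, there are representatives $\gamma_i^{(0)}$ of a basis of $H(V,Q)$ and elements $\gamma_i^{(j)}\in V$, $j\geq 1$, with $K(\gamma_i^{(0)}+\hbar\gamma_i^{(1)}+\hbar^2\gamma_i^{(2)}+\cdots)=0$ for every $i$. *)

theory Defs
  imports
    "HOL-Library.Multiset"
    "HOL-Computational_Algebra.Formal_Power_Series"
begin

unbundle fps_syntax

section \<open>Differential BV algebras\<close>

text \<open>\<open>signed n x\<close> is \<open>(-1)\<^sup>n x\<close>.\<close>

definition signed :: "int \<Rightarrow> 'a::ab_group_add \<Rightarrow> 'a" where
  "signed n x = (if even n then x else - x)"

text \<open>
  The underlying (ungraded) space of the algebra is a whole type of class \<open>ring\<close>, which supplies
  the associative bilinear product; \<open>gr j\<close> is the homogeneous component of degree \<open>j\<close>.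
  The unit is a parameter, since class \<open>ring_1\<close> would exclude the zero algebra.
\<close>

locale graded_comm_algebra = vector_space scale
  for scale :: "'k::field_char_0 \<Rightarrow> 'v::ring \<Rightarrow> 'v"
  and gr :: "int \<Rightarrow> 'v set"
  and one :: 'v +
  assumes scale_mult_left: "scale c x * y = scale c (x * y)"
    and scale_mult_right: "x * scale c y = scale c (x * y)"
    and one_left: "one * x = x"
    and one_right: "x * one = x"
    and gr_subspace: "subspace (gr j)"
    and gr_direct_sum:
      "\<exists>!f. (\<forall>j. f j \<in> gr j) \<and> finite {j. f j \<noteq> 0} \<and> v = (\<Sum>j | f j \<noteq> 0. f j)"
    and one_degree: "one \<in> gr 0"
    and mult_degree: "x \<in> gr i \<Longrightarrow> y \<in> gr j \<Longrightarrow> x * y \<in> gr (i + j)"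
    and graded_commute: "x \<in> gr i \<Longrightarrow> y \<in> gr j \<Longrightarrow> x * y = signed (i * j) (y * x)"

definition graded_derivation ::
  "('k::field \<Rightarrow> 'v::ring \<Rightarrow> 'v) \<Rightarrow> (int \<Rightarrow> 'v set) \<Rightarrow> int \<Rightarrow> ('v \<Rightarrow> 'v) \<Rightarrow> bool" where
  "graded_derivation scale gr n D \<longleftrightarrow>
     Vector_Spaces.linear scale scale D \<and>
     (\<forall>i. D ` gr i \<subseteq> gr (i + n)) \<and>
     (\<forall>i x y. x \<in> gr i \<longrightarrow> D (x * y) = D x * y + signed (n * i) (x * D y))"

locale differential_graded_algebra = graded_comm_algebra scale gr one
  for scale :: "'k::field_char_0 \<Rightarrow> 'v::ring \<Rightarrow> 'v"
  and gr :: "int \<Rightarrow> 'v set"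
  and one :: 'v
  and Q :: "'v \<Rightarrow> 'v" +
  assumes Q_derivation: "graded_derivation scale gr 1 Q"
    and Q_square: "Q (Q x) = 0"

locale BV_algebra = graded_comm_algebra scale gr one
  for scale :: "'k::field_char_0 \<Rightarrow> 'v::ring \<Rightarrow> 'v"
  and gr :: "int \<Rightarrow> 'v set"
  and one :: 'v
  and \<Delta> :: "'v \<Rightarrow> 'v" +
  assumes Delta_linear: "Vector_Spaces.linear scale scale \<Delta>"
    and Delta_degree: "\<Delta> ` gr j \<subseteq> gr (j - 1)"
    and Delta_square: "\<Delta> (\<Delta> x) = 0"
    and Delta_second_order: "v \<in> gr j \<Longrightarrow>
      graded_derivation scale gr (j - 1) (\<lambda>w. \<Delta> (v * w) - \<Delta> v * w - signed j (v * \<Delta> w))"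

locale differential_BV_algebra =
  differential_graded_algebra scale gr one Q + BV_algebra scale gr one \<Delta>
  for scale :: "'k::field_char_0 \<Rightarrow> 'v::ring \<Rightarrow> 'v"
  and gr :: "int \<Rightarrow> 'v set"
  and one :: 'v
  and Q :: "'v \<Rightarrow> 'v"
  and \<Delta> :: "'v \<Rightarrow> 'v" +
  assumes Q_Delta_anticommute: "Q (\<Delta> x) + \<Delta> (Q x) = 0"


section \<open>The spectral sequence of a filtered complex\<close>

text \<open>
  For a decreasing filtration \<open>F\<close> preserved by a differential \<open>d\<close>, with
  \<open>Z\<^sub>r\<^sup>p = {x \<in> F\<^sup>p. d x \<in> F\<^sup>p\<^sup>+\<^sup>r}\<close>, the pages are
  \<open>E\<^sub>r\<^sup>p = Z\<^sub>r\<^sup>p / (Z\<^sub>r\<^sub>-\<^sub>1\<^sup>p\<^sup>+\<^sup>1 + d Z\<^sub>r\<^sub>-\<^sub>1\<^sup>p\<^sup>-\<^sup>r\<^sup>+\<^sup>1)\<close>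
  and \<open>d\<^sub>r : E\<^sub>r\<^sup>p \<rightarrow> E\<^sub>r\<^sup>p\<^sup>+\<^sup>r\<close> is the map induced by \<open>d\<close>. The page index is an integer
  so that the formula also covers \<open>E\<^sub>0\<^sup>p = F\<^sup>p / F\<^sup>p\<^sup>+\<^sup>1\<close>.
\<close>

definition ss_cycles :: "(int \<Rightarrow> 'a set) \<Rightarrow> ('a \<Rightarrow> 'a) \<Rightarrow> int \<Rightarrow> int \<Rightarrow> 'a set" where
  "ss_cycles F d r p = {x \<in> F p. d x \<in> F (p + r)}"

definition ss_boundaries ::
  "(int \<Rightarrow> 'a::ab_group_add set) \<Rightarrow> ('a \<Rightarrow> 'a) \<Rightarrow> int \<Rightarrow> int \<Rightarrow> 'a set" where
  "ss_boundaries F d r p =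
     {z + d w | z w. z \<in> ss_cycles F d (r - 1) (p + 1) \<and> w \<in> ss_cycles F d (r - 1) (p - r + 1)}"

definition ss_rel ::
  "(int \<Rightarrow> 'a::ab_group_add set) \<Rightarrow> ('a \<Rightarrow> 'a) \<Rightarrow> int \<Rightarrow> int \<Rightarrow> ('a \<times> 'a) set" where
  "ss_rel F d r p = {(x, y). x \<in> ss_cycles F d r p \<and> y \<in> ss_cycles F d r p \<and>
     x - y \<in> ss_boundaries F d r p}"

definition ss_page ::
  "(int \<Rightarrow> 'a::ab_group_add set) \<Rightarrow> ('a \<Rightarrow> 'a) \<Rightarrow> int \<Rightarrow> int \<Rightarrow> 'a set set" where
  "ss_page F d r p = ss_cycles F d r p // ss_rel F d r p"

definition ss_differential ::
  "(int \<Rightarrow> 'a::ab_group_add set) \<Rightarrow> ('a \<Rightarrow> 'a) \<Rightarrow> int \<Rightarrow> int \<Rightarrow> 'a set \<Rightarrow> 'a set" where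
  "ss_differential F d r p X = (\<Union>x\<in>X. ss_rel F d r (p + r) `` {d x})"

definition degenerates_at_E1 :: "(int \<Rightarrow> 'a::ab_group_add set) \<Rightarrow> ('a \<Rightarrow> 'a) \<Rightarrow> bool" where
  "degenerates_at_E1 F d \<longleftrightarrow>
     (\<forall>r\<ge>1. \<forall>p. \<forall>X \<in> ss_page F d r p. ss_differential F d r p X = ss_rel F d r (p + r) `` {0})"


section \<open>Formal power series in \<open>\<hbar>\<close>\<close>

text \<open>
  \<open>V[[\<hbar>]]\<close> is the type \<open>'v fps\<close>, with the library's (Cauchy) product: no Koszul sign arises
  from \<open>\<hbar>\<close>, which has even degree.
\<close>

definition hbar_extend :: "('a \<Rightarrow> 'b) \<Rightarrow> 'a fps \<Rightarrow> 'b fps" where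
  "hbar_extend f x = Abs_fps (\<lambda>n. f (x $ n))"

definition hbar_times :: "'a::zero fps \<Rightarrow> 'a fps" where
  "hbar_times x = Abs_fps (\<lambda>n. if n = 0 then 0 else x $ (n - 1))"

text \<open>\<open>F\<^sup>p = \<hbar>\<^sup>p V[[\<hbar>]]\<close>, extended by \<open>F\<^sup>p = V[[\<hbar>]]\<close> to \<open>p < 0\<close>.\<close>

definition hbar_filtration :: "int \<Rightarrow> 'a::zero fps set" where
  "hbar_filtration p = (hbar_times ^^ nat p) ` UNIV"


section \<open>Quantum smooth formality\<close>

context differential_BV_algebra
begin

definition component :: "'v \<Rightarrow> int \<Rightarrow> 'v" where
  "component v = (THE f. (\<forall>j. f j \<in> gr j) \<and> finite {j. f j \<noteq> 0} \<and> v = (\<Sum>j | f j \<noteq> 0. f j))"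

text \<open>The linear map that is \<open>v \<mapsto> (-1)\<^sup>j v\<close> on \<open>gr j\<close>.\<close>

definition parity_inv :: "'v \<Rightarrow> 'v" where
  "parity_inv v = (\<Sum>j | component v j \<noteq> 0. signed j (component v j))"

definition K :: "'v fps \<Rightarrow> 'v fps" where
  "K x = hbar_extend Q x + hbar_times (hbar_extend \<Delta> x)"

subsection \<open>Homogeneous bases of the cohomology\<close>

definition cohomologous :: "('v \<times> 'v) set" where
  "cohomologous = {(x, y). Q x = 0 \<and> Q y = 0 \<and> x - y \<in> range Q}"

definition cohomology :: "'v set set" where
  "cohomology = {x. Q x = 0} // cohomologous"

text \<open>The class \<open>\<Sum>X\<in>A. c\<^sub>X X\<close>.\<close>

definition class_comb :: "'v set set \<Rightarrow> ('v set \<Rightarrow> 'k) \<Rightarrow> 'v set" where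
  "class_comb A c =
     {v. \<exists>x. (\<forall>X\<in>A. x X \<in> X) \<and> v - (\<Sum>X\<in>A. scale (c X) (x X)) \<in> range Q}"

definition homogeneous_basis :: "'v set set \<Rightarrow> bool" where
  "homogeneous_basis B \<longleftrightarrow>
     B \<subseteq> cohomology \<and>
     (\<forall>X\<in>B. \<exists>j. X \<inter> gr j \<noteq> {}) \<and>
     (\<forall>A c. finite A \<and> A \<subseteq> B \<and> class_comb A c = cohomologous `` {0} \<longrightarrow> (\<forall>X\<in>A. c X = 0)) \<and>
     (\<forall>Y\<in>cohomology. \<exists>A c. finite A \<and> A \<subseteq> B \<and> Y = class_comb A c)"

text \<open>A nonzero homogeneous class has representatives in a single degree only.\<close>

definition odd_class :: "'v set \<Rightarrow> bool" where
  "odd_class X \<longleftrightarrow> (\<exists>j. odd j \<and> X \<inter> gr j \<noteq> {})"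

subsection \<open>Formal power series in the coordinates dual to a basis\<close>

text \<open>
  The coordinates are indexed by the basis classes themselves. Monomials are finite multisets of
  classes, odd coordinates occurring at most once. The multiset \<open>m\<close> stands for the product of its
  coordinates written in increasing order with respect to a fixed linear order \<open>r\<close> on the basis,
  and a series \<open>\<Gamma>\<close> is the function giving its coefficients in \<open>V[[\<hbar>]]\<close>, written to the left of
  the monomials.
\<close>

definition monomials :: "'v set set \<Rightarrow> 'v set multiset set" where
  "monomials B = {m. set_mset m \<subseteq> B \<and> (\<forall>X. odd_class X \<longrightarrow> count m X \<le> 1)}"

definition mdegree :: "'v set multiset \<Rightarrow> int" where
  "mdegree m = int (size (filter_mset odd_class m))"

text \<open>The exponent of the sign in \<open>t\<^sup>a t\<^sup>b = \<plusminus> t\<^sup>a\<^sup>+\<^sup>b\<close>: the odd pairs that are out of order.\<close>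

definition inversions ::
  "('v set \<times> 'v set) set \<Rightarrow> 'v set multiset \<Rightarrow> 'v set multiset \<Rightarrow> int" where
  "inversions r a b =
     int (card {(X, Y). X \<in># a \<and> Y \<in># b \<and> odd_class X \<and> odd_class Y \<and> (Y, X) \<in> r \<and> X \<noteq> Y})"

definition series :: "'v set set \<Rightarrow> ('v set multiset \<Rightarrow> 'v fps) set" where
  "series B = {\<Gamma>. \<forall>m. m \<notin> monomials B \<longrightarrow> \<Gamma> m = 0}"

text \<open>\<open>(v t\<^sup>a) (w t\<^sup>b) = (-1)\<^bsup>|a||w|\<^esup> v w t\<^sup>a t\<^sup>b\<close>\<close>

definition series_mult ::
  "'v set set \<Rightarrow> ('v set \<times> 'v set) set \<Rightarrow> ('v set multiset \<Rightarrow> 'v fps) \<Rightarrow>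
   ('v set multiset \<Rightarrow> 'v fps) \<Rightarrow> ('v set multiset \<Rightarrow> 'v fps)" where
  "series_mult B r \<Gamma> \<Gamma>' m =
     (if m \<in> monomials B then
        \<Sum>a | a \<subseteq># m. signed (inversions r a (m - a))
          (\<Gamma> a * (if even (mdegree a) then \<Gamma>' (m - a) else hbar_extend parity_inv (\<Gamma>' (m - a))))
      else 0)"

text \<open>\<open>\<Gamma> \<mapsto> (-1)\<^bsup>|\<Gamma>|\<^esup> \<Gamma>\<close> for the total parity\<close>

definition series_parity_inv ::
  "('v set multiset \<Rightarrow> 'v fps) \<Rightarrow> ('v set multiset \<Rightarrow> 'v fps)" where
  "series_parity_inv \<Gamma> m = signed (mdegree m) (hbar_extend parity_inv (\<Gamma> m))"

definition series_bracket ::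
  "'v set set \<Rightarrow> ('v set \<times> 'v set) set \<Rightarrow> ('v set multiset \<Rightarrow> 'v fps) \<Rightarrow>
   ('v set multiset \<Rightarrow> 'v fps) \<Rightarrow> ('v set multiset \<Rightarrow> 'v fps)" where
  "series_bracket B r \<Gamma> \<Gamma>' m =
     hbar_extend \<Delta> (series_mult B r \<Gamma> \<Gamma>' m)
     - series_mult B r (hbar_extend \<Delta> \<circ> \<Gamma>) \<Gamma>' m
     - series_mult B r (series_parity_inv \<Gamma>) (hbar_extend \<Delta> \<circ> \<Gamma>') m"

definition even_series :: "('v set multiset \<Rightarrow> 'v fps) \<Rightarrow> bool" where
  "even_series \<Gamma> \<longleftrightarrow> (\<forall>m n j. odd (j + mdegree m) \<longrightarrow> component (\<Gamma> m $ n) j = 0)"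

definition quantum_master_equation ::
  "'v set set \<Rightarrow> ('v set \<times> 'v set) set \<Rightarrow> ('v set multiset \<Rightarrow> 'v fps) \<Rightarrow> bool" where
  "quantum_master_equation B r \<Gamma> \<longleftrightarrow>
     (\<forall>m. K (\<Gamma> m) + hbar_extend (scale (1 / 2)) (series_bracket B r \<Gamma> \<Gamma> m) = 0)"

definition versal_solution ::
  "'v set set \<Rightarrow> ('v set \<times> 'v set) set \<Rightarrow> ('v set multiset \<Rightarrow> 'v fps) \<Rightarrow> bool" where
  "versal_solution B r \<Gamma> \<longleftrightarrow>
     \<Gamma> \<in> series B \<and> even_series \<Gamma> \<and> \<Gamma> {#} = 0 \<and> quantum_master_equation B r \<Gamma> \<and>
     (\<forall>X\<in>B. \<Gamma> {#X#} $ 0 \<in> X \<and> (\<exists>j. \<Gamma> {#X#} $ 0 \<in> gr j))"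

text \<open>
  The order \<open>r\<close> is only the convention for writing monomials: changing it rescales the
  monomials by signs.
\<close>

definition quantum_smooth_formal :: bool where
  "quantum_smooth_formal \<longleftrightarrow>
     (\<exists>B r \<Gamma>. homogeneous_basis B \<and> linear_order_on B r \<and> versal_solution B r \<Gamma>)"

end

end

theory Submission
  imports Defs "HOL-Library.Function_Algebras"
begin

text \<open>
  Both conditions are equivalent to a third one, \<open>cocycles_lift\<close>: every \<open>Q\<close>-cocycle in \<open>V\<close> is the
  constant term of a \<open>K\<close>-cocycle in \<open>V[[\<hbar>]]\<close>.

  For the spectral sequence, a cycle in \<open>F\<^sup>p\<close> can be compared with \<open>\<hbar>\<^sup>p\<close> times a lift of its leading
  coefficient, which shows that lifting makes all differentials vanish. Conversely, if they vanish,
  the coefficient of lowest order of every \<open>K x\<close> is \<open>Q\<close>-exact, so that a cocycle can be lifted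
  one power of \<open>\<hbar>\<close> at a time.

  For a versal solution \<open>\<Gamma>\<close>, the part of the master equation linear in the coordinates says that the
  linear coefficients are \<open>K\<close>-closed lifts of representatives of a basis; all other cocycles lift by
  linearity. Conversely, given lifts of a homogeneous basis, \<open>\<Gamma>\<close> is constructed order by order in
  the coordinates. If an even series \<open>F\<close> solves the equation below some order, the obstruction in
  that order is \<open>[F, F]\<close>, and the formal identity

  \<open>K(exp(F/\<hbar>)) = \<hbar>\<^sup>-\<^sup>1 (K F + [F, F]/2) exp(F/\<hbar>)\<close>

  shows that it is \<open>K\<close>-exact once \<open>\<hbar>\<close> is inverted. Lifting of cocycles makes the cohomology of
  \<open>K\<close> torsion-free over \<open>\<hbar>\<close> (lemma \<open>exact_of_hbar_times_exact\<close>), so the obstruction is already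
  exact in \<open>V[[\<hbar>]]\<close> (lemma \<open>obstruction_exact\<close>). Exponentials are avoided by using the
  identity one power of \<open>F\<close> at a time (lemma \<open>K_rpow\<close>).

  The identity rests on \<open>\<Delta>\<close> being a second-order operator. For three elements of definite parity
  this is a seven-term identity that carries only the signs of permuting the factors
  (\<open>order_two_defect\<close>). For even series the signs of the coefficients cancel against those of
  the monomials, and products can be written with a twisted product \<open>\<star>\<close> without any Koszul signs
  between the two; in this form the computation is that of a commutative algebra.
\<close>

section \<open>Signs and \<open>\<hbar>\<close>-series\<close>

lemma signed_signed [simp]: "signed m (signed n x) = signed (m + n) x"
  by (simp add: signed_def)

lemma signed_cong: "even (m + n) \<Longrightarrow> signed m x = signed n x"
  by (simp add: signed_def)

lemma signed_0 [simp]: "signed n 0 = 0"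
  by (simp add: signed_def)

lemma signed_add: "signed n (x + y) = signed n x + signed n y"
  by (simp add: signed_def)

lemma signed_sum: "signed n (sum f A) = (\<Sum>a\<in>A. signed n (f a))"
  by (simp add: signed_def sum_negf)

lemma signed_mult_left: "signed n x * y = signed n (x * y)" for x :: "'a::ring"
  by (simp add: signed_def)

lemma signed_mult_right: "x * signed n y = signed n (x * y)" for x :: "'a::ring"
  by (simp add: signed_def)

lemma signed_diff: "signed n (x - y) = signed n x - signed n y"
  by (simp add: signed_def)

lemma additive_signed:
  assumes "additive f"
  shows "f (signed n x) = signed n (f x)"
  using assms by (simp add: signed_def additive.minus)

lemma hbar_extend_nth [simp]: "hbar_extend f x $ n = f (x $ n)"
  by (simp add: hbar_extend_def)

lemma hbar_times_nth: "hbar_times x $ n = (if n = 0 then 0 else x $ (n - 1))"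
  by (simp add: hbar_times_def)

lemma hbar_times_nth_simps [simp]: "hbar_times x $ 0 = 0" "hbar_times x $ Suc n = x $ n"
  by (simp_all add: hbar_times_nth)

lemma additive_hbar_extend:
  assumes "additive f"
  shows "additive (hbar_extend f)"
  using assms by (simp add: additive_def fps_eq_iff)

lemma additive_hbar_times: "additive (hbar_times :: 'a::ab_group_add fps \<Rightarrow> _)"
  by (simp add: additive_def fps_eq_iff hbar_times_nth)

lemma hbar_extend_hbar_times:
  assumes "additive f"
  shows "hbar_extend f (hbar_times x) = hbar_times (hbar_extend f x)"
  using additive.zero[OF assms] by (simp add: fps_eq_iff hbar_times_nth)

lemma hbar_times_mult_left: "hbar_times x * y = hbar_times (x * y)" for x :: "'a::ring fps"
proof (rule fps_ext)
  fix n show "(hbar_times x * y) $ n = hbar_times (x * y) $ n"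
    by (cases n) (simp_all add: fps_mult_nth sum.atLeast0_atMost_Suc_shift del: sum.cl_ivl_Suc)
qed

lemma hbar_times_mult_right: "x * hbar_times y = hbar_times (x * y)" for x :: "'a::ring fps"
proof (rule fps_ext)
  fix n show "(x * hbar_times y) $ n = hbar_times (x * y) $ n"
    by (cases n) (auto simp: fps_mult_nth Suc_diff_le intro!: sum.cong)
qed

lemma fps_split: "x = fps_const (x $ 0) + hbar_times (fps_shift 1 x)" for x :: "'a::ab_group_add fps"
  by (rule fps_ext) (simp add: hbar_times_nth)

text \<open>
  An additive, \<open>\<hbar>\<close>-linear operation on series is determined by its values on constants: peeling off
  the constant term \<open>n + 1\<close> times leaves a multiple of \<open>\<hbar>\<^sup>n\<^sup>+\<^sup>1\<close>, which has no \<open>n\<close>-th coefficient.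
\<close>

lemma hbar_linear_eq_0:
  fixes f :: "'a::ab_group_add fps \<Rightarrow> 'b::ab_group_add fps"
  assumes add: "additive f" and hbar: "\<And>x. f (hbar_times x) = hbar_times (f x)"
    and const: "\<And>v. P v \<Longrightarrow> f (fps_const v) = 0" and P: "\<And>n. P (x $ n)"
  shows "f x = 0"
proof -
  have "f x $ n = 0" if "\<And>n. P (x $ n)" for n x
    using that
  proof (induction n arbitrary: x)
    case 0
    have "f x = f (fps_const (x $ 0)) + hbar_times (f (fps_shift 1 x))"
      using arg_cong[OF fps_split[of x], of f] by (simp only: additive.add[OF add] hbar)
    with 0 const show ?case by simp
  next
    case (Suc n)
    have "f x = f (fps_const (x $ 0)) + hbar_times (f (fps_shift 1 x))"
      using arg_cong[OF fps_split[of x], of f] by (simp only: additive.add[OF add] hbar)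
    moreover have "f (fps_shift 1 x) $ n = 0"
      using Suc.prems by (intro Suc.IH) simp
    ultimately show ?case using Suc.prems const by simp
  qed
  with P show ?thesis by (simp add: fps_eq_iff)
qed

lemma hbar_filtration_iff: "x \<in> hbar_filtration p \<longleftrightarrow> (\<forall>n. int n < p \<longrightarrow> x $ n = 0)"
  for x :: "'a::zero fps"
proof -
  have nth: "(hbar_times ^^ k) y $ n = (if n < k then 0 else y $ (n - k))" for k n and y :: "'a fps"
    by (induction k arbitrary: n) (auto simp: hbar_times_nth)
  show ?thesis
  proof
    assume "x \<in> hbar_filtration p"
    then show "\<forall>n. int n < p \<longrightarrow> x $ n = 0"
      by (auto simp: hbar_filtration_def nth)
  next
    assume *: "\<forall>n. int n < p \<longrightarrow> x $ n = 0"
    have "x = (hbar_times ^^ nat p) (fps_shift (nat p) x)"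
      using * by (intro fps_ext) (auto simp: nth)
    then show "x \<in> hbar_filtration p" unfolding hbar_filtration_def by blast
  qed
qed

context differential_BV_algebra
begin

lemma Q_linear: "Vector_Spaces.linear scale scale Q"
  using Q_derivation by (simp add: graded_derivation_def)

lemma Q_add: "Q (x + y) = Q x + Q y" and Q_scale: "Q (scale c x) = scale c (Q x)"
  and Delta_add: "\<Delta> (x + y) = \<Delta> x + \<Delta> y" and Delta_scale: "\<Delta> (scale c x) = scale c (\<Delta> x)"
  using Q_linear Delta_linear
  by (simp_all add: Vector_Spaces.linear_iff)

lemma additive_Q: "additive Q" and additive_Delta: "additive \<Delta>"
  by (simp_all add: additive_def Q_add Delta_add)

lemmas Q_0 [simp] = additive.zero[OF additive_Q]
lemmas Delta_0 [simp] = additive.zero[OF additive_Delta]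
lemmas Q_diff = additive.diff[OF additive_Q]
lemmas Q_minus = additive.minus[OF additive_Q]
lemmas Q_sum = additive.sum[OF additive_Q]

lemma K_nth: "K x $ n = Q (x $ n) + (if n = 0 then 0 else \<Delta> (x $ (n - 1)))"
  by (simp add: K_def hbar_times_nth)

lemma K_nth_simps [simp]: "K x $ 0 = Q (x $ 0)" "K x $ Suc n = Q (x $ Suc n) + \<Delta> (x $ n)"
  by (simp_all add: K_nth)

lemma additive_K: "additive K"
  by (simp add: additive_def fps_eq_iff K_nth Q_add Delta_add)

lemmas K_add = additive.add[OF additive_K]
lemmas K_0 [simp] = additive.zero[OF additive_K]
lemmas K_diff = additive.diff[OF additive_K]
lemmas K_sum = additive.sum[OF additive_K]

lemma K_hbar_times: "K (hbar_times x) = hbar_times (K x)"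
  by (simp add: fps_eq_iff K_nth hbar_times_nth)

abbreviation hscale :: "'k \<Rightarrow> 'v fps \<Rightarrow> 'v fps" where
  "hscale c \<equiv> hbar_extend (scale c)"

lemma K_hscale: "K (hscale c x) = hscale c (K x)"
  by (simp add: fps_eq_iff K_nth Q_scale Delta_scale scale_right_distrib)

lemma K_square: "K (K x) = 0"
proof (rule fps_ext)
  fix n
  have "Q (\<Delta> v) = - \<Delta> (Q v)" for v
    using Q_Delta_anticommute[of v] by (simp add: eq_neg_iff_add_eq_0)
  then show "K (K x) $ n = 0 $ n"
    by (cases n) (simp_all add: K_nth Q_add Delta_add Q_square Delta_square)
qed

section \<open>Degeneration as lifting of cocycles\<close>

definition cocycles_lift :: bool where
  "cocycles_lift \<longleftrightarrow> (\<forall>v. Q v = 0 \<longrightarrow> (\<exists>x. x $ 0 = v \<and> K x = 0))"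

lemma filtration_diff: "x \<in> hbar_filtration p \<Longrightarrow> y \<in> hbar_filtration p \<Longrightarrow> x - y \<in> hbar_filtration p"
  for x :: "'v fps"
  by (simp add: hbar_filtration_iff)

lemma zero_in_filtration: "(0 :: 'v fps) \<in> hbar_filtration p"
  by (simp add: hbar_filtration_iff)

lemma ss_boundaries_diff:
  assumes "x \<in> ss_boundaries hbar_filtration K r p" "y \<in> ss_boundaries hbar_filtration K r p"
  shows "x - y \<in> ss_boundaries hbar_filtration K r p"
proof -
  from assms obtain z w z' w' where xy: "x = z + K w" "y = z' + K w'" and
    zw: "z \<in> ss_cycles hbar_filtration K (r-1) (p+1)" "z' \<in> ss_cycles hbar_filtration K (r-1) (p+1)"
    "w \<in> ss_cycles hbar_filtration K (r-1) (p-r+1)" "w' \<in> ss_cycles hbar_filtration K (r-1) (p-r+1)"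
    unfolding ss_boundaries_def by blast
  have "x - y = (z - z') + K (w - w')"
    by (simp add: xy K_diff)
  moreover have "z - z' \<in> ss_cycles hbar_filtration K (r-1) (p+1)"
    "w - w' \<in> ss_cycles hbar_filtration K (r-1) (p-r+1)"
    using zw by (simp_all add: ss_cycles_def K_diff filtration_diff)
  ultimately show ?thesis unfolding ss_boundaries_def by blast
qed

lemma zero_in_ss_boundaries: "0 \<in> ss_boundaries hbar_filtration K r p"
  unfolding ss_boundaries_def ss_cycles_def using zero_in_filtration
  by (auto intro!: exI[of _ "0::'v fps"])

lemma equiv_ss_rel: "equiv (ss_cycles hbar_filtration K r p) (ss_rel hbar_filtration K r p)"
proof (rule equivI)
  show "refl_on (ss_cycles hbar_filtration K r p) (ss_rel hbar_filtration K r p)"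
    by (simp add: refl_on_def ss_rel_def zero_in_ss_boundaries)
  show "ss_rel hbar_filtration K r p \<subseteq> ss_cycles hbar_filtration K r p \<times> ss_cycles hbar_filtration K r p"
    by (auto simp: ss_rel_def)
  show "sym (ss_rel hbar_filtration K r p)"
    unfolding sym_def ss_rel_def
    using ss_boundaries_diff[OF zero_in_ss_boundaries] by fastforce
  show "trans (ss_rel hbar_filtration K r p)"
  proof (rule transI)
    fix x y z
    assume "(x, y) \<in> ss_rel hbar_filtration K r p" "(y, z) \<in> ss_rel hbar_filtration K r p"
    moreover from this have "(x - y) - (0 - (y - z)) \<in> ss_boundaries hbar_filtration K r p"
      by (intro ss_boundaries_diff[OF _ ss_boundaries_diff[OF zero_in_ss_boundaries]])
        (auto simp: ss_rel_def)
    ultimately show "(x, z) \<in> ss_rel hbar_filtration K r p"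
      by (simp add: ss_rel_def)
  qed
qed

lemma K_ss_cycle:
  "x \<in> ss_cycles hbar_filtration K r p \<Longrightarrow> K x \<in> ss_cycles hbar_filtration K r (p + r)"
  by (simp add: ss_cycles_def K_square zero_in_filtration)

lemma K_ss_boundary:
  assumes x: "x \<in> ss_boundaries hbar_filtration K r p"
  shows "K x \<in> ss_boundaries hbar_filtration K r (p + r)"
proof -
  from x obtain z w where "x = z + K w" and z: "z \<in> ss_cycles hbar_filtration K (r-1) (p+1)"
    unfolding ss_boundaries_def by blast
  then have "K x = 0 + K z" by (simp add: K_add K_square)
  moreover have "0 \<in> ss_cycles hbar_filtration K (r-1) (p + r + 1)"
    by (simp add: ss_cycles_def zero_in_filtration)
  ultimately show ?thesis unfolding ss_boundaries_def using z by fastforce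
qed

text \<open>
  The class \<open>d\<^sub>r [x]\<close> is represented by \<open>K x\<close>, whichever representative \<open>x\<close> is taken, so it vanishes
  exactly if \<open>K x\<close> is a boundary of the \<open>r\<close>-th page.
\<close>

lemma degenerates_iff_boundaries:
  "degenerates_at_E1 hbar_filtration K \<longleftrightarrow>
    (\<forall>r\<ge>1. \<forall>p. \<forall>x\<in>ss_cycles hbar_filtration K r p. K x \<in> ss_boundaries hbar_filtration K r (p + r))"
proof -
  have "(ss_differential hbar_filtration K r p X = ss_rel hbar_filtration K r (p + r) `` {0})
      \<longleftrightarrow> K x \<in> ss_boundaries hbar_filtration K r (p + r)"
    if X: "X = ss_rel hbar_filtration K r p `` {x}" and x: "x \<in> ss_cycles hbar_filtration K r p"
    for r p x X
  proof -
    let ?R = "ss_rel hbar_filtration K r"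
    have same_class: "?R (p + r) `` {K y} = ?R (p + r) `` {K x}" if "y \<in> X" for y
    proof (rule equiv_class_eq[OF equiv_ss_rel])
      from that have "y \<in> ss_cycles hbar_filtration K r p" "x - y \<in> ss_boundaries hbar_filtration K r p"
        by (auto simp: X ss_rel_def)
      then show "(K y, K x) \<in> ?R (p + r)"
        using K_ss_cycle x K_ss_boundary ss_boundaries_diff[OF zero_in_ss_boundaries]
        by (fastforce simp: ss_rel_def K_diff)
    qed
    have "x \<in> X"
      using equiv_class_self[OF equiv_ss_rel x] X by simp
    then have "X \<noteq> {}" by blast
    moreover have "(\<Union>y\<in>X. ?R (p + r) `` {K y}) = (\<Union>y\<in>X. ?R (p + r) `` {K x})"
      by (rule SUP_cong[OF refl]) (rule same_class)
    ultimately have "ss_differential hbar_filtration K r p X = ?R (p + r) `` {K x}"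
      unfolding ss_differential_def by simp
    moreover have "0 \<in> ss_cycles hbar_filtration K r (p + r)"
      by (simp add: ss_cycles_def zero_in_filtration)
    ultimately show ?thesis
      using eq_equiv_class_iff[OF equiv_ss_rel K_ss_cycle[OF x], of 0] K_ss_cycle[OF x]
      by (auto simp: ss_rel_def)
  qed
  then show ?thesis
    unfolding degenerates_at_E1_def ss_page_def quotient_def by fastforce
qed

text \<open>
  If all cocycles lift, a cycle \<open>\<hbar>\<^sup>p x\<close> differs from \<open>\<hbar>\<^sup>p\<close> times a lift of its leading coefficient by
  an element of \<open>F\<^sup>p\<^sup>+\<^sup>1\<close> with the same image under \<open>K\<close>, so that image is a boundary.
\<close>

lemma cocycles_lift_imp_degenerates:
  assumes lift: cocycles_lift
  shows "degenerates_at_E1 hbar_filtration K"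
  unfolding degenerates_iff_boundaries
proof (intro allI impI ballI)
  fix r p :: int and x
  assume r: "1 \<le> r" and x: "x \<in> ss_cycles hbar_filtration K r p"
  have "\<exists>w\<in>hbar_filtration (p + 1). K w = K x"
  proof (cases "p < 0")
    case True
    \<comment> \<open>In negative degrees the filtration is constant, so \<open>x\<close> itself lies in \<open>F\<^sup>p\<^sup>+\<^sup>1\<close>.\<close>
    then show ?thesis by (auto simp: hbar_filtration_iff)
  next
    case False
    then obtain k where p: "p = int k" by (metis nonneg_int_cases not_less)
    have low: "x $ n = 0" if "n < k" for n
      using x that by (simp add: ss_cycles_def hbar_filtration_iff p)
    have "K x $ k = 0"
      using x r by (simp add: ss_cycles_def hbar_filtration_iff p)
    moreover have "\<Delta> (x $ (k - 1)) = 0" if "k \<noteq> 0"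
      using low[of "k - 1"] that by simp
    ultimately have "Q (x $ k) = 0"
      by (auto simp: K_nth split: if_splits)
    then obtain y where y: "y $ 0 = x $ k" "K y = 0"
      using lift by (auto simp: cocycles_lift_def)
    let ?w = "x - (hbar_times ^^ k) y"
    have nth: "(hbar_times ^^ k) y $ n = (if n < k then 0 else y $ (n - k))" for n
      by (induction k arbitrary: n) (auto simp: hbar_times_nth)
    have "K ((hbar_times ^^ k) y) = (hbar_times ^^ k) (K y)"
      by (induction k) (simp_all add: K_hbar_times)
    also have "\<dots> = 0"
      unfolding y(2) by (induction k) (simp_all add: fps_eq_iff hbar_times_nth)
    finally have "K ?w = K x" by (simp add: K_diff)
    moreover have "?w \<in> hbar_filtration (p + 1)"
      using low y(1) by (auto simp: hbar_filtration_iff nth p less_Suc_eq dest: nat_int_comparison(2)[THEN iffD2])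
    ultimately show ?thesis by blast
  qed
  then obtain w where w: "w \<in> hbar_filtration (p + 1)" "K x = 0 + K w" by auto
  moreover have "0 \<in> ss_cycles hbar_filtration K (r - 1) (p + r + 1)"
    by (simp add: ss_cycles_def zero_in_filtration)
  moreover have "w \<in> ss_cycles hbar_filtration K (r - 1) (p + r - r + 1)"
    using w x by (simp add: ss_cycles_def)
  ultimately show "K x \<in> ss_boundaries hbar_filtration K r (p + r)"
    unfolding ss_boundaries_def by blast
qed

text \<open>
  On a degenerate page the leading coefficient of \<open>K x\<close> is \<open>Q\<close>-exact: the boundary equation
  \<open>K x = z + K w\<close> with \<open>w \<in> F\<^sup>1\<close> replaces \<open>x\<close> by \<open>w / \<hbar>\<close> and lowers \<open>r\<close> by one.
\<close>

lemma degenerates_leading_exact: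
  assumes deg: "degenerates_at_E1 hbar_filtration K"
    and "K x \<in> hbar_filtration (int r)"
  shows "K x $ r \<in> range Q"
  using assms(2)
proof (induction r arbitrary: x)
  case 0
  then show ?case by simp
next
  case (Suc r)
  have "x \<in> ss_cycles hbar_filtration K (int (Suc r)) 0"
    using Suc.prems by (simp add: ss_cycles_def) (simp add: hbar_filtration_iff)
  moreover have "1 \<le> int (Suc r)" by simp
  ultimately have "K x \<in> ss_boundaries hbar_filtration K (int (Suc r)) (0 + int (Suc r))"
    using deg unfolding degenerates_iff_boundaries by blast
  then obtain z w where xzw: "K x = z + K w"
    and z: "z \<in> hbar_filtration (int r + 2)" and w: "w \<in> hbar_filtration 1" "K w \<in> hbar_filtration (int r + 1)"
    unfolding ss_boundaries_def ss_cycles_def by (auto simp: algebra_simps)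
  from w(1) have w_eq: "w = hbar_times (fps_shift 1 w)"
    by (simp add: hbar_filtration_iff fps_eq_iff hbar_times_nth)
  have Kw: "K w $ Suc n = K (fps_shift 1 w) $ n" for n
    using arg_cong[OF w_eq, of K] by (simp only: K_hbar_times hbar_times_nth_simps)
  have "K (fps_shift 1 w) \<in> hbar_filtration (int r)"
    using w(2) unfolding hbar_filtration_iff Kw[symmetric] by (simp del: K_nth_simps)
  from Suc.IH[OF this] have "K w $ Suc r \<in> range Q"
    by (simp only: Kw)
  moreover have "z $ Suc r = 0"
    using z by (simp add: hbar_filtration_iff)
  ultimately show ?case
    by (simp add: xzw del: K_nth_simps)
qed

text \<open>
  Hence a partial lift can be corrected in degree \<open>\<hbar>\<^sup>r\<close> without changing lower coefficients, and the
  corrections converge \<open>\<hbar>\<close>-adically.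
\<close>

lemma degenerates_imp_cocycles_lift:
  assumes deg: "degenerates_at_E1 hbar_filtration K"
  shows cocycles_lift
  unfolding cocycles_lift_def
proof (intro allI impI)
  fix v assume v: "Q v = 0"
  let ?P = "\<lambda>n x. x $ 0 = v \<and> K x \<in> hbar_filtration (int (Suc n))"
  let ?R = "\<lambda>n x y. \<forall>i\<le>n. y $ i = (x :: 'v fps) $ i"
  have "\<exists>f. \<forall>n. ?P n (f n) \<and> ?R n (f n) (f (Suc n))"
  proof (rule dependent_nat_choice)
    show "\<exists>x. ?P 0 x"
      using v by (intro exI[of _ "fps_const v"]) (auto simp: hbar_filtration_iff)
  next
    fix x n assume x: "?P n x"
    then obtain u where u: "K x $ Suc n = Q u"
      using degenerates_leading_exact[OF deg, of x "Suc n"] by (auto simp del: K_nth_simps)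
    \<comment> \<open>Subtracting \<open>u \<hbar>\<^sup>n\<^sup>+\<^sup>1\<close> cancels the leading coefficient \<open>Q u\<close> of \<open>K x\<close>.\<close>
    let ?y = "x - Abs_fps (\<lambda>i. if i = Suc n then u else 0)"
    have "K ?y $ i = 0" if "i < Suc (Suc n)" for i
    proof (cases "i = Suc n")
      case True
      from u have "Q u = Q (x $ Suc n) + \<Delta> (x $ n)" by simp
      with True show ?thesis by (simp add: Q_diff)
    next
      case False
      with that have "i < Suc n" by simp
      with x have "K x $ i = 0" by (simp add: hbar_filtration_iff del: K_nth_simps)
      with \<open>i < Suc n\<close> show ?thesis by (auto simp: K_nth split: if_splits)
    qed
    then have "K ?y \<in> hbar_filtration (int (Suc (Suc n)))"
      unfolding hbar_filtration_iff by (metis of_nat_less_iff)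
    moreover have "?y $ 0 = v" "?R n x ?y" using x by auto
    ultimately show "\<exists>y. ?P (Suc n) y \<and> ?R n x y" by blast
  qed
  then obtain f where f: "\<And>n. ?P n (f n)" and step: "\<And>n. ?R n (f n) (f (Suc n))" by blast
  have stable: "f n $ i = f i $ i" if "i \<le> n" for i n
    using that by (induction rule: dec_induct) (use step in auto)
  let ?x = "Abs_fps (\<lambda>n. f n $ n)"
  have "K ?x $ n = K (f n) $ n" for n
    using stable[of "n - 1" n] by (simp add: K_nth)
  moreover have "K (f n) $ n = 0" for n
    using f[of n] by (simp add: hbar_filtration_iff del: K_nth_simps)
  ultimately have "K ?x = 0" by (simp add: fps_eq_iff)
  moreover have "?x $ 0 = v" using f[of 0] by simp
  ultimately show "\<exists>x. x $ 0 = v \<and> K x = 0" by blast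
qed

text \<open>
  Lifting of cocycles makes the cohomology of \<open>K\<close> torsion-free: if \<open>\<hbar> x = K y\<close>, subtracting from
  \<open>y\<close> a lift of its constant term leaves a multiple of \<open>\<hbar>\<close>.
\<close>

lemma exact_of_hbar_times_exact:
  assumes lift: cocycles_lift and x: "hbar_times x \<in> range K"
  shows "x \<in> range K"
proof -
  from x obtain y where y: "hbar_times x = K y" by blast
  then have "Q (y $ 0) = 0" by (metis K_nth_simps(1) hbar_times_nth_simps(1))
  with lift obtain w where w: "w $ 0 = y $ 0" "K w = 0" by (auto simp: cocycles_lift_def)
  have "y - w = hbar_times (fps_shift 1 (y - w))"
    using w by (intro fps_ext) (auto simp: hbar_times_nth)
  then have "hbar_times x = hbar_times (K (fps_shift 1 (y - w)))"
    using y w(2) by (metis K_diff K_hbar_times diff_zero)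
  then have "x $ n = K (fps_shift 1 (y - w)) $ n" for n
    by (metis hbar_times_nth_simps(2))
  then have "x = K (fps_shift 1 (y - w))" by (rule fps_ext)
  then show ?thesis by blast
qed

end

section \<open>Parity\<close>

context differential_BV_algebra
begin

lemma component_spec:
  "component v j \<in> gr j" "finite {j. component v j \<noteq> 0}" "v = (\<Sum>j | component v j \<noteq> 0. component v j)"
proof -
  have "(\<forall>j. component v j \<in> gr j) \<and> finite {j. component v j \<noteq> 0} \<and>
      v = (\<Sum>j | component v j \<noteq> 0. component v j)"
    unfolding component_def by (rule theI'[OF gr_direct_sum])
  then show "component v j \<in> gr j" "finite {j. component v j \<noteq> 0}"
    "v = (\<Sum>j | component v j \<noteq> 0. component v j)" by blast+
qed

lemma component_eqI:
  assumes J: "finite J" "\<And>j. j \<notin> J \<Longrightarrow> f j = 0" and f: "\<And>j. f j \<in> gr j" and v: "v = sum f J"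
  shows "component v = f"
  unfolding component_def
proof (rule the1_equality[OF gr_direct_sum], intro conjI allI)
  have sub: "{j. f j \<noteq> 0} \<subseteq> J" using J(2) by blast
  with J(1) show "finite {j. f j \<noteq> 0}" by (rule finite_subset[rotated])
  show "v = (\<Sum>j | f j \<noteq> 0. f j)"
    unfolding v using J(1) sub by (intro sum.mono_neutral_right) auto
qed (rule f)

lemma component_sum:
  assumes "finite J" "{j. component v j \<noteq> 0} \<subseteq> J"
  shows "v = (\<Sum>j\<in>J. component v j)"
proof -
  have "v = (\<Sum>j | component v j \<noteq> 0. component v j)" by (rule component_spec(3))
  also have "\<dots> = (\<Sum>j\<in>J. component v j)"
    using assms by (intro sum.mono_neutral_left) auto
  finally show ?thesis .
qed

lemma component_add: "component (x + y) = (\<lambda>j. component x j + component y j)"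
proof (rule component_eqI)
  let ?J = "{j. component x j \<noteq> 0} \<union> {j. component y j \<noteq> 0}"
  show "finite ?J" by (simp add: component_spec(2))
  then show "x + y = (\<Sum>j\<in>?J. component x j + component y j)"
    unfolding sum.distrib by (intro arg_cong2[of _ _ _ _ "(+)"] component_sum) auto
  show "component x j + component y j \<in> gr j" for j
    by (intro subspace_add[OF gr_subspace] component_spec(1))
qed auto

lemma component_scale: "component (scale c x) = (\<lambda>j. scale c (component x j))"
proof (rule component_eqI)
  let ?J = "{j. component x j \<noteq> 0}"
  show "finite ?J" by (simp add: component_spec(2))
  show "scale c x = (\<Sum>j\<in>?J. scale c (component x j))"
    unfolding scale_sum_right[symmetric] using component_spec(3)[of x] by simp
  show "scale c (component x j) \<in> gr j" for j
    by (intro subspace_scale[OF gr_subspace] component_spec(1))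
qed auto

lemma component_homogeneous: "x \<in> gr i \<Longrightarrow> component x = (\<lambda>j. if j = i then x else 0)"
  by (rule component_eqI[of "{i}"]) (auto intro: subspace_0[OF gr_subspace])

text \<open>
  Only \<open>p\<close> modulo 2 matters, and 0 has both parities.
\<close>

definition has_parity :: "int \<Rightarrow> 'v \<Rightarrow> bool" where
  "has_parity p v \<longleftrightarrow> (\<forall>j. odd (j + p) \<longrightarrow> component v j = 0)"

lemma gr_has_parity: "x \<in> gr j \<Longrightarrow> even (j + p) \<Longrightarrow> has_parity p x"
  by (auto simp: has_parity_def component_homogeneous)

lemma has_parity_0 [simp]: "has_parity p 0"
  by (rule gr_has_parity[of 0 p]) (simp_all add: subspace_0[OF gr_subspace])

lemma has_parity_cong: "even (p + q) \<Longrightarrow> has_parity p x \<longleftrightarrow> has_parity q x"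
  by (auto simp: has_parity_def)

lemma has_parity_add: "has_parity p x \<Longrightarrow> has_parity p y \<Longrightarrow> has_parity p (x + y)"
  by (simp add: has_parity_def component_add)

lemma has_parity_scale: "has_parity p x \<Longrightarrow> has_parity p (scale c x)"
  by (simp add: has_parity_def component_scale)

lemma has_parity_minus: "has_parity p x \<Longrightarrow> has_parity p (- x)"
  using has_parity_scale[of p x "-1"] by simp

lemma has_parity_diff: "has_parity p x \<Longrightarrow> has_parity p y \<Longrightarrow> has_parity p (x - y)"
  using has_parity_add[of p x "- y"] has_parity_minus by simp

lemma has_parity_sum: "(\<And>a. a \<in> A \<Longrightarrow> has_parity p (f a)) \<Longrightarrow> has_parity p (sum f A)"
  by (induction A rule: infinite_finite_induct) (simp_all add: has_parity_add)

lemma has_parity_both_eq_0: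
  assumes "has_parity p x" "has_parity (p + 1) x"
  shows "x = 0"
proof -
  have "component x j = 0" for j
    using assms by (cases "even (j + p)") (auto simp: has_parity_def)
  then show ?thesis using component_spec(3)[of x] by simp
qed

lemma has_parity_decompose:
  obtains a b where "has_parity p a" "has_parity (p + 1) b" "v = a + b"
proof
  let ?J = "{j. component v j \<noteq> 0}"
  let ?a = "\<Sum>j | j \<in> ?J \<and> even (j + p). component v j"
  let ?b = "\<Sum>j | j \<in> ?J \<and> odd (j + p). component v j"
  have "has_parity p (component v j)" if "even (j + p)" for j p
    using that by (rule gr_has_parity[OF component_spec(1)])
  then show "has_parity p ?a" "has_parity (p + 1) ?b"
    by (auto intro!: has_parity_sum)
  have "{j \<in> ?J. odd (j + p)} = ?J - {j \<in> ?J. even (j + p)}" by blast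
  then have "sum (component v) ?J = ?a + ?b"
    using sum.subset_diff[OF _ component_spec(2), of "{j \<in> ?J. even (j + p)}" v "component v"]
    by (simp add: add.commute subset_iff)
  then show "v = ?a + ?b" using component_spec(3)[of v] by simp
qed

lemma has_parity_induct [consumes 1, case_names zero add homogeneous]:
  assumes x: "has_parity p x" and P: "P 0" "\<And>u v. P u \<Longrightarrow> P v \<Longrightarrow> P (u + v)"
    "\<And>j u. u \<in> gr j \<Longrightarrow> even (j + p) \<Longrightarrow> P u"
  shows "P x"
proof -
  have "P (\<Sum>j\<in>J. component x j)" if "finite J" "J \<subseteq> {j. component x j \<noteq> 0}" for J
    using that
  proof (induction J)
    case (insert j J)
    then have "even (j + p)" using x by (auto simp: has_parity_def)
    with insert P(2)[OF P(3)[OF component_spec(1)[of x j]]] show ?case by simp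
  qed (simp add: P)
  then show ?thesis using component_spec(2)[of x] component_spec(3)[of x] by fastforce
qed

lemma has_parity_additive_eq_0:
  assumes "additive f" "has_parity p x" "\<And>j u. u \<in> gr j \<Longrightarrow> even (j + p) \<Longrightarrow> f u = 0"
  shows "f x = 0"
  using assms(2) by (induction rule: has_parity_induct)
    (use assms in \<open>auto simp: additive.zero additive.add\<close>)

lemma has_parity_additive:
  assumes "additive f" "has_parity p x" "\<And>j u. u \<in> gr j \<Longrightarrow> even (j + p) \<Longrightarrow> has_parity q (f u)"
  shows "has_parity q (f x)"
  using assms(2) by (induction rule: has_parity_induct)
    (use assms in \<open>auto simp: additive.zero additive.add has_parity_add\<close>)

lemma Q_degree: "x \<in> gr j \<Longrightarrow> Q x \<in> gr (j + 1)"
  using Q_derivation by (auto simp: graded_derivation_def)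

lemma Delta_gr: "x \<in> gr j \<Longrightarrow> \<Delta> x \<in> gr (j - 1)"
  using Delta_degree by blast

lemma has_parity_Q: "has_parity p x \<Longrightarrow> has_parity (p + 1) (Q x)"
  by (rule has_parity_additive[OF additive_Q]) (auto intro!: gr_has_parity dest: Q_degree)

lemma has_parity_Delta: "has_parity p x \<Longrightarrow> has_parity (p + 1) (\<Delta> x)"
  by (rule has_parity_additive[OF additive_Delta]) (auto intro!: gr_has_parity dest: Delta_gr)

lemma has_parity_mult:
  assumes "has_parity p x" "has_parity q y"
  shows "has_parity (p + q) (x * y)"
proof (rule has_parity_additive[OF _ assms(1)])
  show "additive (\<lambda>x. x * y)" by (simp add: additive_def algebra_simps)
  fix i u assume u: "u \<in> gr i" "even (i + p)"
  show "has_parity (p + q) (u * y)"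
  proof (rule has_parity_additive[OF _ assms(2)])
    show "additive (\<lambda>y. u * y)" by (simp add: additive_def algebra_simps)
    fix j v assume "v \<in> gr j" "even (j + q)"
    with u show "has_parity (p + q) (u * v)"
      using gr_has_parity[OF mult_degree[of u i v j], of "p + q"] by simp
  qed
qed

lemma parity_inv_has_parity:
  assumes "has_parity p v"
  shows "parity_inv v = signed p v"
proof -
  have "parity_inv v = (\<Sum>j | component v j \<noteq> 0. signed p (component v j))"
    unfolding parity_inv_def
    by (intro sum.cong refl signed_cong) (use assms in \<open>auto simp: has_parity_def\<close>)
  then show ?thesis using component_spec(3)[of v] by (simp flip: signed_sum)
qed

section \<open>Multilinear identities for elements of definite parity\<close>

text \<open>
  The two expressions below vanish for a super-commutative product and for an odd derivation,
  respectively. In the second one \<open>D y\<close> is moved to the left of \<open>x\<close>, which absorbs the sign that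
  \<open>D\<close> produces on passing \<open>x\<close>.
\<close>

definition commutator :: "int \<Rightarrow> 'a::ring \<Rightarrow> 'a \<Rightarrow> 'a" where
  "commutator n x y = x * y - signed n (y * x)"

definition leibniz_defect :: "('a::ring \<Rightarrow> 'a) \<Rightarrow> int \<Rightarrow> 'a \<Rightarrow> 'a \<Rightarrow> 'a" where
  "leibniz_defect D n x y = D (x * y) - D x * y - signed n (D y * x)"

text \<open>
  The condition that \<open>D\<close> has order two as a seven-term identity. In every term \<open>D\<close> is applied first
  and stands on the left, so the only signs are those of the permutations of \<open>x, y, z\<close>, with
  \<open>p, q, r\<close> the parities; no sign comes from moving \<open>D\<close> itself.
\<close>

definition order_two_defect :: "('a::ring \<Rightarrow> 'a) \<Rightarrow> int \<Rightarrow> int \<Rightarrow> int \<Rightarrow> 'a \<Rightarrow> 'a \<Rightarrow> 'a \<Rightarrow> 'a" where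
  "order_two_defect D p q r x y z =
     D (x * y * z) - D (x * y) * z - signed (p * (q + r)) (D (y * z) * x)
     - signed (q * r) (D (x * z) * y) + D x * y * z + signed (p * q) (D y * x * z)
     + signed ((p + q) * r) (D z * x * y)"

lemma additive_commutator:
  "additive (\<lambda>x. commutator n x y)" "additive (\<lambda>y. commutator n x y)"
  by (simp_all add: additive_def commutator_def distrib_left distrib_right signed_add)

lemma additive_leibniz_defect:
  assumes "additive D"
  shows "additive (\<lambda>x. leibniz_defect D n x y)" "additive (\<lambda>y. leibniz_defect D n x y)"
  by (simp_all add: additive_def leibniz_defect_def distrib_left distrib_right signed_add
      additive.add[OF assms])

lemma additive_order_two_defect:
  assumes "additive D"
  shows "additive (\<lambda>x. order_two_defect D p q r x y z)"
    "additive (\<lambda>y. order_two_defect D p q r x y z)"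
    "additive (\<lambda>z. order_two_defect D p q r x y z)"
  by (simp_all add: additive_def order_two_defect_def distrib_left distrib_right signed_add
      additive.add[OF assms])

lemma commutator_has_parity:
  assumes "has_parity p x" "has_parity q y"
  shows "commutator (p * q) x y = 0"
proof (rule has_parity_additive_eq_0[OF additive_commutator(1) assms(1)],
    rule has_parity_additive_eq_0[OF additive_commutator(2) assms(2)])
  fix i j u v assume "u \<in> gr i" "even (i + p)" "v \<in> gr j" "even (j + q)"
  moreover from this have "even (i * j + p * q)" by (metis even_add even_mult_iff)
  ultimately show "commutator (p * q) u v = 0"
    using graded_commute[of u i v j] by (simp add: commutator_def signed_cong)
qed

lemma Q_leibniz_has_parity:
  assumes "has_parity p x" "has_parity q y"
  shows "leibniz_defect Q (p * q) x y = 0"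
proof (rule has_parity_additive_eq_0[OF additive_leibniz_defect(1)[OF additive_Q] assms(1)],
    rule has_parity_additive_eq_0[OF additive_leibniz_defect(2)[OF additive_Q] assms(2)])
  fix i j u v assume u: "u \<in> gr i" "even (i + p)" and v: "v \<in> gr j" "even (j + q)"
  have "Q (u * v) = Q u * v + signed i (u * Q v)"
    using Q_derivation u(1) by (auto simp: graded_derivation_def)
  also have "signed i (u * Q v) = signed (i + i * (j + 1)) (Q v * u)"
    using graded_commute[OF u(1) Q_degree[OF v(1)]] by simp
  also have "\<dots> = signed (p * q) (Q v * u)"
  proof (rule signed_cong)
    have "even (i * j + p * q)" using u(2) v(2) by (metis even_add even_mult_iff)
    then show "even (i + i * (j + 1) + p * q)" by (simp add: algebra_simps)
  qed
  finally show "leibniz_defect Q (p * q) u v = 0" by (simp add: leibniz_defect_def)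
qed

text \<open>
  The derivation property of \<open>d\<^sub>x(w) = \<Delta>(x w) - \<Delta>(x) w - (-1)\<^sup>i x \<Delta>(w)\<close> on the product \<open>y z\<close>, with
  every factor to which \<open>\<Delta>\<close> is applied brought to the left.
\<close>

lemma Delta_order_two_gr:
  assumes x: "x \<in> gr i" and y: "y \<in> gr j" and z: "z \<in> gr k"
  shows "order_two_defect \<Delta> i j k x y z = 0"
proof -
  have dx: "graded_derivation scale gr (i - 1) (\<lambda>w. \<Delta> (x * w) - \<Delta> x * w - signed i (x * \<Delta> w))"
    by (rule Delta_second_order[OF x])
  have "\<Delta> (x * (y * z)) - \<Delta> x * (y * z) - signed i (x * \<Delta> (y * z)) =
      (\<Delta> (x * y) - \<Delta> x * y - signed i (x * \<Delta> y)) * z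
      + signed ((i - 1) * j) (y * (\<Delta> (x * z) - \<Delta> x * z - signed i (x * \<Delta> z)))"
    using dx y unfolding graded_derivation_def by blast
  then have "\<Delta> (x * y * z) = \<Delta> x * y * z + signed i (x * \<Delta> (y * z))
      + \<Delta> (x * y) * z - \<Delta> x * y * z - signed i (x * \<Delta> y) * z
      + signed ((i - 1) * j) (y * \<Delta> (x * z)) - signed ((i - 1) * j) (y * \<Delta> x) * z
      - signed ((i - 1) * j + i) (y * x * \<Delta> z)"
    by (simp add: algebra_simps signed_diff signed_add signed_mult_left signed_mult_right)
  moreover have "signed i (x * \<Delta> (y * z)) = signed (i * (j + k)) (\<Delta> (y * z) * x)"
    using graded_commute[OF x Delta_gr[OF mult_degree[OF y z]]]
    by (simp add: signed_def algebra_simps)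
  moreover have "signed i (x * \<Delta> y) = signed (i * j) (\<Delta> y * x)"
    using graded_commute[OF x Delta_gr[OF y]] by (simp add: signed_def algebra_simps)
  moreover have "signed ((i - 1) * j) (y * \<Delta> (x * z)) = signed (j * k) (\<Delta> (x * z) * y)"
    using graded_commute[OF y Delta_gr[OF mult_degree[OF x z]]]
    by (auto simp: signed_def algebra_simps)
  moreover have "signed ((i - 1) * j) (y * \<Delta> x) = \<Delta> x * y"
    using graded_commute[OF y Delta_gr[OF x]] by (auto simp: signed_def algebra_simps)
  moreover have "signed ((i - 1) * j + i) (y * x * \<Delta> z) = signed ((i + j) * k) (\<Delta> z * x * y)"
  proof -
    have "\<Delta> z * (y * x) = signed (j * i) (\<Delta> z * x * y)"
      by (simp add: graded_commute[OF y x] signed_mult_right mult.assoc)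
    then have "y * x * \<Delta> z = signed ((j + i) * (k - 1) + j * i) (\<Delta> z * x * y)"
      using graded_commute[OF mult_degree[OF y x] Delta_gr[OF z]] by simp
    then show ?thesis by (auto intro!: signed_cong)
  qed
  ultimately show ?thesis
    by (simp add: order_two_defect_def signed_mult_left)
qed

lemma Delta_order_two_has_parity:
  assumes "has_parity p x" "has_parity q y" "has_parity r z"
  shows "order_two_defect \<Delta> p q r x y z = 0"
proof (rule has_parity_additive_eq_0[OF additive_order_two_defect(1)[OF additive_Delta] assms(1)],
    rule has_parity_additive_eq_0[OF additive_order_two_defect(2)[OF additive_Delta] assms(2)],
    rule has_parity_additive_eq_0[OF additive_order_two_defect(3)[OF additive_Delta] assms(3)])
  fix i j k u v w
  assume "u \<in> gr i" "even (i + p)" "v \<in> gr j" "even (j + q)" "w \<in> gr k" "even (k + r)"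
  moreover from this have "signed (p * q) a = signed (i * j) a"
    "signed (q * r) a = signed (j * k) a" "signed (p * (q + r)) a = signed (i * (j + k)) a"
    "signed ((p + q) * r) a = signed ((i + j) * k) a" for a :: 'v
    by (intro signed_cong; simp; blast)+
  ultimately show "order_two_defect \<Delta> p q r u v w = 0"
    using Delta_order_two_gr[of u i v j w k] by (simp add: order_two_defect_def)
qed

section \<open>Extension to \<open>\<hbar>\<close>-series\<close>

definition has_hbar_parity :: "int \<Rightarrow> 'v fps \<Rightarrow> bool" where
  "has_hbar_parity p x \<longleftrightarrow> (\<forall>n. has_parity p (x $ n))"

lemma hbar_parity_0 [simp]: "has_hbar_parity p 0"
  by (simp add: has_hbar_parity_def)

lemma hbar_parity_add: "has_hbar_parity p x \<Longrightarrow> has_hbar_parity p y \<Longrightarrow> has_hbar_parity p (x + y)"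
  by (simp add: has_hbar_parity_def has_parity_add)

lemma hbar_parity_diff: "has_hbar_parity p x \<Longrightarrow> has_hbar_parity p y \<Longrightarrow> has_hbar_parity p (x - y)"
  by (simp add: has_hbar_parity_def has_parity_diff)

lemma hbar_parity_signed: "has_hbar_parity p x \<Longrightarrow> has_hbar_parity p (signed n x)"
  by (simp add: has_hbar_parity_def signed_def has_parity_minus)

lemma hbar_parity_sum: "(\<And>a. a \<in> A \<Longrightarrow> has_hbar_parity p (f a)) \<Longrightarrow> has_hbar_parity p (sum f A)"
  by (induction A rule: infinite_finite_induct) (simp_all add: hbar_parity_add)

lemma hbar_parity_mult: "has_hbar_parity p x \<Longrightarrow> has_hbar_parity q y \<Longrightarrow> has_hbar_parity (p + q) (x * y)"
  by (simp add: has_hbar_parity_def fps_mult_nth has_parity_sum has_parity_mult)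

lemma hbar_parity_hscale: "has_hbar_parity p x \<Longrightarrow> has_hbar_parity p (hscale c x)"
  by (simp add: has_hbar_parity_def has_parity_scale)

abbreviation "hQ \<equiv> hbar_extend Q"
abbreviation "hDelta \<equiv> hbar_extend \<Delta>"

lemma hbar_parity_hDelta: "has_hbar_parity p x \<Longrightarrow> has_hbar_parity (p + 1) (hDelta x)"
  by (simp add: has_hbar_parity_def has_parity_Delta)

lemma hbar_parity_K: "has_hbar_parity p x \<Longrightarrow> has_hbar_parity (p + 1) (K x)"
  by (simp add: has_hbar_parity_def K_nth has_parity_add has_parity_Q has_parity_Delta)

lemma hbar_parity_both_eq_0: "has_hbar_parity p x \<Longrightarrow> has_hbar_parity (p + 1) x \<Longrightarrow> x = 0"
  using has_parity_both_eq_0 by (auto simp: has_hbar_parity_def fps_eq_iff)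

lemma hbar_parity_decompose:
  obtains a b where "has_hbar_parity p a" "has_hbar_parity (p + 1) b" "x = a + b"
proof -
  have "\<forall>n. \<exists>a b. has_parity p a \<and> has_parity (p + 1) b \<and> x $ n = a + b"
    using has_parity_decompose by metis
  then obtain a b where "\<And>n. has_parity p (a n) \<and> has_parity (p + 1) (b n) \<and> x $ n = a n + b n"
    by metis
  then have "has_hbar_parity p (Abs_fps a)" "has_hbar_parity (p + 1) (Abs_fps b)" "x = Abs_fps a + Abs_fps b"
    by (simp_all add: has_hbar_parity_def fps_eq_iff)
  then show ?thesis by (rule that)
qed

text \<open>
  Since \<open>K\<close> reverses parity, a primitive of an element of definite parity may be replaced by its
  component of the opposite parity.
\<close>

lemma hbar_parity_primitive:
  assumes "K x = y" "has_hbar_parity (p + 1) y"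
  obtains a b where "K a = y" "has_hbar_parity p a" "has_hbar_parity (p + 1) b" "x = a + b"
proof -
  obtain a b where ab: "has_hbar_parity p a" "has_hbar_parity (p + 1) b" "x = a + b"
    by (rule hbar_parity_decompose)
  have "K b = y - K a" using assms(1) ab(3) by (simp add: K_add algebra_simps)
  then have "has_hbar_parity (p + 1) (K b)" using hbar_parity_diff assms(2) hbar_parity_K[OF ab(1)] by simp
  then have "K b = 0" using hbar_parity_K[OF ab(2)] by (rule hbar_parity_both_eq_0)
  then have "K a = y" using assms(1) ab(3) by (simp add: K_add)
  then show ?thesis using ab by (rule that)
qed

lemma signed_hbar_times: "signed n (hbar_times x) = hbar_times (signed n x)" for x :: "'v fps"
  by (rule additive_signed[OF additive_hbar_times, symmetric])

lemma signed_fps_const: "signed n (fps_const x) = fps_const (signed n x)" for x :: 'v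
  by (simp add: signed_def fps_const_neg)

lemma hbar_extend_const: "f 0 = 0 \<Longrightarrow> hbar_extend f (fps_const x) = fps_const (f x)"
  by (rule fps_ext) (simp add: fps_const_def)

lemmas hbar_simps = signed_hbar_times hbar_times_mult_left hbar_times_mult_right
  hbar_extend_hbar_times[OF additive_Q] hbar_extend_hbar_times[OF additive_Delta]
  additive.diff[OF additive_hbar_times, symmetric] additive.add[OF additive_hbar_times, symmetric]

lemmas const_simps = signed_fps_const hbar_extend_const fps_const_mult
  fps_const_add fps_const_sub

lemma defects_const:
  "commutator n (fps_const x) (fps_const y) = fps_const (commutator n x y)"
  "leibniz_defect hQ n (fps_const x) (fps_const y) = fps_const (leibniz_defect Q n x y)"
  "order_two_defect hDelta i j k (fps_const x) (fps_const y) (fps_const z)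
    = fps_const (order_two_defect \<Delta> i j k x y z)"
  for x y z :: 'v
  by (simp_all add: commutator_def leibniz_defect_def order_two_defect_def const_simps)

lemma commutator_hbar_parity:
  assumes "has_hbar_parity p x" "has_hbar_parity q y"
  shows "commutator (p * q) x y = 0"
proof (rule hbar_linear_eq_0[where P = "has_parity p", OF additive_commutator(1)],
    goal_cases)
  case (2 u)
  show ?case
    by (rule hbar_linear_eq_0[where P = "has_parity q", OF additive_commutator(2)])
      (use assms(2) 2 in \<open>simp_all add: has_hbar_parity_def defects_const commutator_has_parity\<close>,
       simp add: commutator_def hbar_simps)
qed (use assms(1) in \<open>simp_all add: has_hbar_parity_def commutator_def hbar_simps\<close>)

lemma hQ_leibniz_hbar_parity:
  assumes "has_hbar_parity p x" "has_hbar_parity q y"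
  shows "leibniz_defect hQ (p * q) x y = 0"
proof (rule hbar_linear_eq_0[where P = "has_parity p",
      OF additive_leibniz_defect(1)[OF additive_hbar_extend[OF additive_Q]]], goal_cases)
  case (2 u)
  show ?case
    by (rule hbar_linear_eq_0[where P = "has_parity q",
          OF additive_leibniz_defect(2)[OF additive_hbar_extend[OF additive_Q]]])
      (use assms(2) 2 in \<open>simp_all add: has_hbar_parity_def defects_const Q_leibniz_has_parity\<close>,
       simp add: leibniz_defect_def hbar_simps)
qed (use assms(1) in \<open>simp_all add: has_hbar_parity_def leibniz_defect_def hbar_simps\<close>)

lemma hDelta_order_two_hbar_parity:
  assumes "has_hbar_parity p x" "has_hbar_parity q y" "has_hbar_parity r z"
  shows "order_two_defect hDelta p q r x y z = 0"
proof (rule hbar_linear_eq_0[where P = "has_parity p",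
      OF additive_order_two_defect(1)[OF additive_hbar_extend[OF additive_Delta]]], goal_cases)
  case (2 u)
  show ?case
  proof (rule hbar_linear_eq_0[where P = "has_parity q",
      OF additive_order_two_defect(2)[OF additive_hbar_extend[OF additive_Delta]]], goal_cases)
    case (2 v)
    show ?case
      by (rule hbar_linear_eq_0[where P = "has_parity r",
          OF additive_order_two_defect(3)[OF additive_hbar_extend[OF additive_Delta]]])
        (use assms(3) 2 \<open>has_parity p u\<close> in \<open>simp_all add: has_hbar_parity_def defects_const Delta_order_two_has_parity\<close>,
         simp add: order_two_defect_def hbar_simps)
  qed (use assms(2) in \<open>simp_all add: has_hbar_parity_def order_two_defect_def hbar_simps\<close>)
qed (use assms(1) in \<open>simp_all add: has_hbar_parity_def order_two_defect_def hbar_simps\<close>)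

end

section \<open>The twisted product of power series in the coordinates\<close>

definition splits2 :: "'a multiset \<Rightarrow> ('a multiset \<times> 'a multiset) set" where
  "splits2 m = {(a, b). a + b = m}"

definition splits3 :: "'a multiset \<Rightarrow> ('a multiset \<times> 'a multiset \<times> 'a multiset) set" where
  "splits3 m = {(a, b, c). a + b + c = m}"

lemma finite_submultisets: "finite {a. a \<subseteq># m}"
proof (induction m)
  case (add x m)
  have "{a. a \<subseteq># add_mset x m} \<subseteq> {a. a \<subseteq># m} \<union> add_mset x ` {a. a \<subseteq># m}"
  proof
    fix a assume "a \<in> {a. a \<subseteq># add_mset x m}"
    then have a: "a \<subseteq># add_mset x m" by simp
    show "a \<in> {a. a \<subseteq># m} \<union> add_mset x ` {a. a \<subseteq># m}"
    proof (cases "x \<in># a")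
      case True
      with a obtain a' where "a = add_mset x a'" "a' \<subseteq># m"
        by (metis insert_DiffM mset_subset_eq_add_mset_cancel)
      then show ?thesis by simp
    next
      case False
      then have "count a y \<le> count m y" for y
        using mset_subset_eq_count[OF a, of y] by (cases "y = x") (auto simp: not_in_iff)
      then have "a \<subseteq># m" by (rule mset_subset_eqI)
      then show ?thesis by simp
    qed
  qed
  with add.IH show ?case by (meson finite_UnI finite_imageI finite_subset)
qed simp

lemma splits2_eq_image: "splits2 m = (\<lambda>a. (a, m - a)) ` {a. a \<subseteq># m}"
  by (auto simp: splits2_def image_def)

lemma finite_splits2: "finite (splits2 m)"
  by (simp add: splits2_eq_image finite_submultisets)

lemma sum_submultisets: "(\<Sum>a | a \<subseteq># m. f a (m - a)) = (\<Sum>(a, b)\<in>splits2 m. f a b)"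
  unfolding splits2_eq_image by (subst sum.reindex) (auto simp: inj_on_def)

lemma sum_splits2_swap: "(\<Sum>(a, b)\<in>splits2 m. f a b) = (\<Sum>(a, b)\<in>splits2 m. f b a)"
  by (rule sum.reindex_bij_witness[where i = "\<lambda>(a, b). (b, a)" and j = "\<lambda>(a, b). (b, a)"])
    (auto simp: splits2_def add.commute)

lemma sum_splits3_left:
  "(\<Sum>(d, c)\<in>splits2 m. \<Sum>(a, b)\<in>splits2 d. f a b c) = (\<Sum>(a, b, c)\<in>splits3 m. f a b c)"
proof -
  have "(\<Sum>(d, c)\<in>splits2 m. \<Sum>(a, b)\<in>splits2 d. f a b c)
      = (\<Sum>((d, c), (a, b))\<in>(SIGMA (d, c) : splits2 m. splits2 d). f a b c)"
    by (simp add: sum.Sigma finite_splits2 case_prod_unfold)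
  also have "\<dots> = (\<Sum>(a, b, c)\<in>splits3 m. f a b c)"
    by (rule sum.reindex_bij_witness[where i = "\<lambda>(a, b, c). ((a + b, c), (a, b))"
          and j = "\<lambda>((d, c), (a, b)). (a, b, c)"])
      (auto simp: splits2_def splits3_def)
  finally show ?thesis .
qed

lemma sum_splits3_right:
  "(\<Sum>(a, d)\<in>splits2 m. \<Sum>(b, c)\<in>splits2 d. f a b c) = (\<Sum>(a, b, c)\<in>splits3 m. f a b c)"
proof -
  have "(\<Sum>(a, d)\<in>splits2 m. \<Sum>(b, c)\<in>splits2 d. f a b c)
      = (\<Sum>((a, d), (b, c))\<in>(SIGMA (a, d) : splits2 m. splits2 d). f a b c)"
    by (simp add: sum.Sigma finite_splits2 case_prod_unfold)
  also have "\<dots> = (\<Sum>(a, b, c)\<in>splits3 m. f a b c)"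
    by (rule sum.reindex_bij_witness[where i = "\<lambda>(a, b, c). ((a, b + c), (b, c))"
          and j = "\<lambda>((a, d), (b, c)). (a, b, c)"])
      (auto simp: splits2_def splits3_def add.assoc)
  finally show ?thesis .
qed

locale coordinates = differential_BV_algebra scale gr one Q \<Delta>
  for scale :: "'k::field_char_0 \<Rightarrow> 'v::ring \<Rightarrow> 'v"
  and gr :: "int \<Rightarrow> 'v set"
  and one :: 'v
  and Q :: "'v \<Rightarrow> 'v"
  and \<Delta> :: "'v \<Rightarrow> 'v" +
  fixes B :: "'v set set" and r :: "('v set \<times> 'v set) set"
  assumes order: "linear_order_on B r"
begin

abbreviation "M \<equiv> monomials B"

lemma monomials_add: "a + b \<in> M \<Longrightarrow> a \<in> M" "a + b \<in> M \<Longrightarrow> b \<in> M"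
  by (fastforce simp: monomials_def)+

definition odd_part :: "'v set multiset \<Rightarrow> 'v set set" where
  "odd_part a = {X. X \<in># a \<and> odd_class X}"

lemma finite_odd_part [simp]: "finite (odd_part a)"
  by (rule finite_subset[of _ "set_mset a"]) (auto simp: odd_part_def)

lemma odd_part_add: "odd_part (a + b) = odd_part a \<union> odd_part b"
  by (auto simp: odd_part_def)

lemma odd_part_disjoint:
  assumes "a + b \<in> M"
  shows "odd_part a \<inter> odd_part b = {}"
proof -
  have False if "X \<in># a" "X \<in># b" "odd_class X" for X
  proof -
    from that have "0 < count a X" "0 < count b X" by simp_all
    moreover have "count a X + count b X \<le> 1"
      using assms that(3) by (auto simp: monomials_def)
    ultimately show False by linarith
  qed
  then show ?thesis by (auto simp: odd_part_def)
qed

lemma mdegree_add: "mdegree (a + b) = mdegree a + mdegree b"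
  by (simp add: mdegree_def)

lemma mdegree_eq_card:
  assumes "a \<in> M"
  shows "mdegree a = int (card (odd_part a))"
proof -
  have "size (filter_mset odd_class a) = (\<Sum>X\<in>odd_part a. 1)"
    unfolding size_multiset_overloaded_eq
  proof (rule sum.cong)
    show "set_mset (filter_mset odd_class a) = odd_part a"
      by (auto simp: odd_part_def)
    fix X assume "X \<in> odd_part a"
    then have "0 < count a X" "odd_class X" by (simp_all add: odd_part_def)
    moreover from this assms have "count a X \<le> 1" by (simp add: monomials_def)
    ultimately have "count a X = 1" by linarith
    with \<open>odd_class X\<close> show "count (filter_mset odd_class a) X = 1" by simp
  qed
  then show ?thesis by (simp add: mdegree_def)
qed

lemma inversions_eq:
  "inversions r a b = int (card {(X, Y) \<in> odd_part a \<times> odd_part b. (Y, X) \<in> r \<and> X \<noteq> Y})"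
  unfolding inversions_def
  by (intro arg_cong[where f = int] arg_cong[where f = card]) (auto simp: odd_part_def)

lemma inversions_add_left:
  assumes "a + b \<in> M"
  shows "inversions r (a + b) c = inversions r a c + inversions r b c"
proof -
  let ?I = "\<lambda>A. {(X, Y) \<in> A \<times> odd_part c. (Y, X) \<in> r \<and> X \<noteq> Y}"
  have "finite (?I (odd_part a))" for a
    by (rule finite_subset[of _ "odd_part a \<times> odd_part c"]) auto
  moreover have "?I (odd_part a) \<inter> ?I (odd_part b) = {}"
    using odd_part_disjoint[OF assms] by auto
  moreover have "?I (odd_part (a + b)) = ?I (odd_part a) \<union> ?I (odd_part b)"
    by (auto simp: odd_part_add)
  ultimately show ?thesis
    unfolding inversions_eq by (simp add: card_Un_disjoint)
qed

lemma inversions_add_right: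
  assumes "a + b \<in> M"
  shows "inversions r c (a + b) = inversions r c a + inversions r c b"
proof -
  let ?I = "\<lambda>A. {(X, Y) \<in> odd_part c \<times> A. (Y, X) \<in> r \<and> X \<noteq> Y}"
  have "finite (?I (odd_part a))" for a
    by (rule finite_subset[of _ "odd_part c \<times> odd_part a"]) auto
  moreover have "?I (odd_part a) \<inter> ?I (odd_part b) = {}"
    using odd_part_disjoint[OF assms] by auto
  moreover have "?I (odd_part (a + b)) = ?I (odd_part a) \<union> ?I (odd_part b)"
    by (auto simp: odd_part_add)
  ultimately show ?thesis
    unfolding inversions_eq by (simp add: card_Un_disjoint)
qed

text \<open>Every pair of odd coordinates is out of order in exactly one of \<open>t\<^sup>a t\<^sup>b\<close> and \<open>t\<^sup>b t\<^sup>a\<close>.\<close>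

lemma inversions_swap:
  assumes ab: "a + b \<in> M"
  shows "inversions r a b + inversions r b a = mdegree a * mdegree b"
proof -
  let ?P = "odd_part a \<times> odd_part b"
  let ?I = "{(X, Y) \<in> ?P. (Y, X) \<in> r \<and> X \<noteq> Y}"
  let ?J = "{(X, Y) \<in> ?P. (X, Y) \<in> r \<and> X \<noteq> Y}"
  have sub: "odd_part a \<subseteq> B" "odd_part b \<subseteq> B"
    using monomials_add[OF ab] by (auto simp: monomials_def odd_part_def)
  have "X \<noteq> Y \<and> ((X, Y) \<in> r \<longleftrightarrow> (Y, X) \<notin> r)" if "X \<in> odd_part a" "Y \<in> odd_part b" for X Y
  proof -
    have "X \<in> B" "Y \<in> B" "X \<noteq> Y"
      using that sub odd_part_disjoint[OF ab] by auto
    moreover have "total_on B r" "antisym r"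
      using order by (simp_all add: linear_order_on_def partial_order_on_def)
    ultimately show ?thesis
      by (metis antisymD total_on_def)
  qed
  then have "?I \<union> ?J = ?P" "?I \<inter> ?J = {}" by auto
  moreover have "finite ?I" "finite ?J"
    by (rule finite_subset[of _ ?P]; auto)+
  ultimately have "card ?P = card ?I + card ?J"
    using card_Un_disjoint[of ?I ?J] by simp
  moreover have "{(Y, X) \<in> odd_part b \<times> odd_part a. (X, Y) \<in> r \<and> Y \<noteq> X} = prod.swap ` ?J"
    by (auto simp: image_def)
  then have "card {(Y, X) \<in> odd_part b \<times> odd_part a. (X, Y) \<in> r \<and> Y \<noteq> X} = card ?J"
    by (simp add: card_image)
  ultimately show ?thesis
    using monomials_add[OF ab]
    by (simp add: inversions_eq mdegree_eq_card card_cartesian_product flip: of_nat_add of_nat_mult)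
qed

lemma even_inversions_swap:
  assumes "a + b \<in> M"
  shows "even (inversions r a b + inversions r b a + mdegree a * mdegree b)"
  unfolding inversions_swap[OF assms] by simp

text \<open>
  The product of the ordinary, not the super, tensor product with the algebra of the coordinates:
  there is no Koszul sign between coefficients and monomials. On series of even
  total parity it agrees with the super product, since there the parity of a coefficient is that of
  its monomial, and the two signs of a transposition cancel.
\<close>

definition star ::
  "('v set multiset \<Rightarrow> 'v fps) \<Rightarrow> ('v set multiset \<Rightarrow> 'v fps) \<Rightarrow> 'v set multiset \<Rightarrow> 'v fps"
  (infixl "\<star>" 70) where
  "(F \<star> G) m =
    (if m \<in> M then \<Sum>(a, b)\<in>splits2 m. signed (inversions r b a) (F a * G b) else 0)"

text \<open>
  Products of three series as sums over splittings of a monomial into three, the form in which the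
  terms of a trilinear identity can be compared after permuting the factors.
\<close>

definition inversions3 :: "'v set multiset \<Rightarrow> 'v set multiset \<Rightarrow> 'v set multiset \<Rightarrow> int" where
  "inversions3 a b c = inversions r b a + inversions r c a + inversions r c b"

definition star3 ::
  "('v set multiset \<Rightarrow> 'v set multiset \<Rightarrow> 'v set multiset \<Rightarrow> 'v fps) \<Rightarrow> 'v set multiset \<Rightarrow> 'v fps" where
  "star3 f m =
    (if m \<in> M then \<Sum>(a, b, c)\<in>splits3 m. signed (inversions3 a b c) (f a b c) else 0)"

lemma star3_add: "star3 (\<lambda>a b c. f a b c + g a b c) = star3 f + star3 g"
  by (rule ext) (simp add: star3_def signed_add sum.distrib case_prod_unfold)

lemma star3_diff: "star3 (\<lambda>a b c. f a b c - g a b c) = star3 f - star3 g"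
  by (rule ext) (simp add: star3_def signed_diff sum_subtractf case_prod_unfold)

lemma star3_cong:
  assumes "\<And>a b c. a + b + c \<in> M \<Longrightarrow> f a b c = g a b c"
  shows "star3 f = star3 g"
  by (rule ext) (auto simp: star3_def splits3_def assms intro!: sum.cong)

lemma star3_swap12: "star3 f = star3 (\<lambda>a b c. signed (mdegree a * mdegree b) (f b a c))"
proof (rule ext)
  fix m
  have "(\<Sum>(a, b, c)\<in>splits3 m. signed (inversions3 a b c) (f a b c))
    = (\<Sum>(a, b, c)\<in>splits3 m. signed (inversions3 a b c + mdegree a * mdegree b) (f b a c))" if "m \<in> M"
  proof (rule sum.reindex_bij_witness[where i = "\<lambda>(a, b, c). (b, a, c)" and j = "\<lambda>(a, b, c). (b, a, c)"],
      goal_cases)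
    case (5 x)
    obtain a b c where x: "x = (a, b, c)" by (cases x)
    with 5 that have "a + b \<in> M" using monomials_add(1)[of "a + b" c] by (auto simp: splits3_def)
    from even_inversions_swap[OF this] show ?case
      unfolding x by (auto simp: inversions3_def intro!: signed_cong)
  qed (auto simp: splits3_def ac_simps)
  then show "star3 f m = star3 (\<lambda>a b c. signed (mdegree a * mdegree b) (f b a c)) m"
    by (simp add: star3_def)
qed

lemma star3_swap23: "star3 f = star3 (\<lambda>a b c. signed (mdegree b * mdegree c) (f a c b))"
proof (rule ext)
  fix m
  have "(\<Sum>(a, b, c)\<in>splits3 m. signed (inversions3 a b c) (f a b c))
    = (\<Sum>(a, b, c)\<in>splits3 m. signed (inversions3 a b c + mdegree b * mdegree c) (f a c b))" if "m \<in> M"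
  proof (rule sum.reindex_bij_witness[where i = "\<lambda>(a, b, c). (a, c, b)" and j = "\<lambda>(a, b, c). (a, c, b)"],
      goal_cases)
    case (5 x)
    obtain a b c where x: "x = (a, b, c)" by (cases x)
    with 5 that have "b + c \<in> M" using monomials_add(2)[of a "b + c"] by (auto simp: splits3_def add.assoc)
    from even_inversions_swap[OF this] show ?case
      unfolding x by (auto simp: inversions3_def intro!: signed_cong)
  qed (auto simp: splits3_def ac_simps)
  then show "star3 f m = star3 (\<lambda>a b c. signed (mdegree b * mdegree c) (f a c b)) m"
    by (simp add: star3_def)
qed

lemma additive_star3:
  assumes "additive d"
  shows "d (star3 f m) = star3 (\<lambda>a b c. d (f a b c)) m"
  by (simp add: star3_def additive.sum[OF assms] additive_signed[OF assms] additive.zero[OF assms]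
      case_prod_unfold)

lemma star_left_eq_star3:
  assumes d: "additive d"
  shows "(d \<circ> (F \<star> G)) \<star> H = star3 (\<lambda>a b c. d (F a * G b) * H c)"
proof (rule ext)
  fix m
  have "((d \<circ> (F \<star> G)) \<star> H) m = (\<Sum>(e, c)\<in>splits2 m. \<Sum>(a, b)\<in>splits2 e.
      signed (inversions3 a b c) (d (F a * G b) * H c))" if m: "m \<in> M"
    unfolding star_def comp_def
  proof (simp only: m if_True, intro sum.cong refl, clarify)
    fix e c assume "(e, c) \<in> splits2 m"
    with m have e: "e \<in> M" by (auto simp: splits2_def dest: monomials_add)
    then have "inversions r c e + inversions r b a = inversions3 a b c" if "(a, b) \<in> splits2 e" for a b
      using that inversions_add_right[of a b c] by (auto simp: splits2_def inversions3_def)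
    then show "signed (inversions r c e) (d (if e \<in> M then \<Sum>(a, b)\<in>splits2 e.
        signed (inversions r b a) (F a * G b) else 0) * H c)
      = (\<Sum>(a, b)\<in>splits2 e. signed (inversions3 a b c) (d (F a * G b) * H c))"
      using e by (auto simp: additive.sum[OF d] additive_signed[OF d] sum_distrib_right signed_sum
          signed_mult_left case_prod_unfold intro!: sum.cong)
  qed
  then show "((d \<circ> (F \<star> G)) \<star> H) m = star3 (\<lambda>a b c. d (F a * G b) * H c) m"
    by (simp add: star3_def sum_splits3_left) (simp add: star_def)
qed

lemma star_right_eq_star3: "F \<star> (G \<star> H) = star3 (\<lambda>a b c. F a * G b * H c)"
proof (rule ext)
  fix m
  have "(F \<star> (G \<star> H)) m = (\<Sum>(a, e)\<in>splits2 m. \<Sum>(b, c)\<in>splits2 e.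
      signed (inversions3 a b c) (F a * G b * H c))" if m: "m \<in> M"
    unfolding star_def
  proof (simp only: m if_True, intro sum.cong refl, clarify)
    fix a e assume "(a, e) \<in> splits2 m"
    with m have e: "e \<in> M" by (auto simp: splits2_def dest: monomials_add)
    then have "inversions r e a + inversions r c b = inversions3 a b c" if "(b, c) \<in> splits2 e" for b c
      using that inversions_add_left[of b c a] by (auto simp: splits2_def inversions3_def)
    then show "signed (inversions r e a) (F a * (if e \<in> M then \<Sum>(b, c)\<in>splits2 e.
        signed (inversions r c b) (G b * H c) else 0))
      = (\<Sum>(b, c)\<in>splits2 e. signed (inversions3 a b c) (F a * G b * H c))"
      using e by (auto simp: sum_distrib_left signed_sum mult.assoc
          signed_mult_right case_prod_unfold intro!: sum.cong)
  qed
  then show "(F \<star> (G \<star> H)) m = star3 (\<lambda>a b c. F a * G b * H c) m"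
    by (simp add: star3_def sum_splits3_right) (simp add: star_def)
qed

lemma star_star_eq_star3: "F \<star> G \<star> H = star3 (\<lambda>a b c. F a * G b * H c)"
  using star_left_eq_star3[of id F G H] by (simp add: additive_def)

lemma star_assoc: "F \<star> (G \<star> H) = F \<star> G \<star> H"
  by (simp add: star_star_eq_star3 star_right_eq_star3)

lemma star_add_left: "(F + F') \<star> G = F \<star> G + F' \<star> G"
  by (rule ext) (simp add: star_def distrib_right signed_add sum.distrib case_prod_unfold)

lemma star_diff_left: "(F - F') \<star> G = F \<star> G - F' \<star> G"
  by (rule ext) (simp add: star_def left_diff_distrib signed_diff sum_subtractf case_prod_unfold)

lemma star_hbar_times: "(hbar_times \<circ> F) \<star> G = hbar_times \<circ> (F \<star> G)"
  by (rule ext) (simp add: star_def hbar_times_mult_left signed_hbar_times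
      additive.sum[OF additive_hbar_times] additive.zero[OF additive_hbar_times] case_prod_unfold)

lemma additive_hscale: "additive (hscale c)"
  by (simp add: additive_def fps_eq_iff scale_right_distrib)

lemma hscale_mult_left: "hscale c x * y = hscale c (x * y)"
  by (rule fps_ext) (simp add: fps_mult_nth scale_mult_left scale_sum_right)

lemma star_hscale: "(hscale c \<circ> F) \<star> G = hscale c \<circ> (F \<star> G)"
  by (rule ext) (simp add: star_def hscale_mult_left additive_signed[OF additive_hscale]
      additive.sum[OF additive_hscale] additive.zero[OF additive_hscale] case_prod_unfold)

lemma star_outside: "m \<notin> M \<Longrightarrow> (F \<star> G) m = 0"
  by (simp add: star_def)

section \<open>Series of definite total parity\<close>

definition has_total_parity :: "int \<Rightarrow> ('v set multiset \<Rightarrow> 'v fps) \<Rightarrow> bool" where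
  "has_total_parity p F \<longleftrightarrow> (\<forall>m. has_hbar_parity (p + mdegree m) (F m))"

lemma even_series_iff: "even_series F \<longleftrightarrow> has_total_parity 0 F"
  by (auto simp: even_series_def has_total_parity_def has_hbar_parity_def has_parity_def)

lemma total_parity_star:
  assumes "has_total_parity p F" "has_total_parity q G"
  shows "has_total_parity (p + q) (F \<star> G)"
  unfolding has_total_parity_def
proof
  fix m
  have "has_hbar_parity (p + q + mdegree m) (F a * G b)" if "(a, b) \<in> splits2 m" for a b
    using hbar_parity_mult[of "p + mdegree a" "F a" "q + mdegree b" "G b"] assms that
    by (auto simp: has_total_parity_def splits2_def mdegree_add ac_simps)
  then show "has_hbar_parity (p + q + mdegree m) ((F \<star> G) m)"
    by (auto simp: star_def intro!: hbar_parity_sum hbar_parity_signed)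
qed

lemma total_parity_hDelta: "has_total_parity p F \<Longrightarrow> has_total_parity (p + 1) (hDelta \<circ> F)"
  unfolding has_total_parity_def
proof
  fix m assume "\<forall>m. has_hbar_parity (p + mdegree m) (F m)"
  then have "has_hbar_parity (p + mdegree m + 1) (hDelta (F m))" by (intro hbar_parity_hDelta) simp
  then show "has_hbar_parity (p + 1 + mdegree m) ((hDelta \<circ> F) m)" by (simp add: ac_simps)
qed

lemma hbar_parity_mult_swap: "has_hbar_parity p x \<Longrightarrow> has_hbar_parity q y \<Longrightarrow> x * y = signed (p * q) (y * x)"
  using commutator_hbar_parity[of p x q y] unfolding commutator_def right_minus_eq by blast

lemma star_commute:
  assumes "has_total_parity 0 F" "has_total_parity 0 G"
  shows "F \<star> G = G \<star> F"
proof (rule ext)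
  fix m
  have "signed (inversions r b a) (F a * G b) = signed (inversions r a b) (G b * F a)"
    if "m \<in> M" "(a, b) \<in> splits2 m" for a b
  proof -
    have "F a * G b = signed (mdegree a * mdegree b) (G b * F a)"
      using assms by (intro hbar_parity_mult_swap) (simp_all add: has_total_parity_def)
    then show ?thesis
      using even_inversions_swap[of a b] that by (auto simp: splits2_def intro!: signed_cong)
  qed
  then have "(F \<star> G) m = (if m \<in> M then \<Sum>(a, b)\<in>splits2 m. signed (inversions r a b) (G b * F a) else 0)"
    by (auto simp: star_def intro!: sum.cong)
  also have "\<dots> = (G \<star> F) m"
    by (subst sum_splits2_swap) (simp add: star_def)
  finally show "(F \<star> G) m = (G \<star> F) m" .
qed

lemma hQ_star:
  assumes "has_total_parity 0 F" "has_total_parity 0 G"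
  shows "hQ \<circ> (F \<star> G) = (hQ \<circ> F) \<star> G + (hQ \<circ> G) \<star> F"
proof (rule ext)
  fix m
  have "signed (inversions r b a) (hQ (F a * G b))
      = signed (inversions r b a) (hQ (F a) * G b) + signed (inversions r a b) (hQ (G b) * F a)"
    if "m \<in> M" "(a, b) \<in> splits2 m" for a b
  proof -
    have "leibniz_defect hQ (mdegree a * mdegree b) (F a) (G b) = 0"
      using assms by (intro hQ_leibniz_hbar_parity) (simp_all add: has_total_parity_def)
    then have "hQ (F a * G b) = hQ (F a) * G b + signed (mdegree a * mdegree b) (hQ (G b) * F a)"
      by (simp add: leibniz_defect_def algebra_simps)
    then show ?thesis
      using even_inversions_swap[of a b] that
      by (auto simp: splits2_def signed_add intro!: signed_cong)
  qed
  then have "(\<Sum>(a, b)\<in>splits2 m. signed (inversions r b a) (hQ (F a * G b)))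
      = (\<Sum>(a, b)\<in>splits2 m. signed (inversions r b a) (hQ (F a) * G b))
      + (\<Sum>(a, b)\<in>splits2 m. signed (inversions r a b) (hQ (G b) * F a))" if "m \<in> M"
    unfolding sum.distrib[symmetric] using that by (intro sum.cong) auto
  also have "(\<Sum>(a, b)\<in>splits2 m. signed (inversions r a b) (hQ (G b) * F a))
      = (\<Sum>(a, b)\<in>splits2 m. signed (inversions r b a) (hQ (G a) * F b))"
    by (rule sum_splits2_swap)
  finally show "(hQ \<circ> (F \<star> G)) m = ((hQ \<circ> F) \<star> G + (hQ \<circ> G) \<star> F) m"
    using additive_hbar_extend[OF additive_Q]
    by (simp add: star_def additive.sum additive_signed additive.zero case_prod_unfold)
qed

text \<open>
  The signs of the seven-term identity for coefficients are those of the monomials, so they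
  disappear for even series.
\<close>

lemma hDelta_star_star:
  assumes "has_total_parity 0 F" "has_total_parity 0 G" "has_total_parity 0 H"
  shows "hDelta \<circ> (F \<star> G \<star> H) =
    (hDelta \<circ> (F \<star> G)) \<star> H + (hDelta \<circ> (G \<star> H)) \<star> F + (hDelta \<circ> (F \<star> H)) \<star> G
    - (hDelta \<circ> F) \<star> G \<star> H - (hDelta \<circ> G) \<star> F \<star> H - (hDelta \<circ> H) \<star> F \<star> G"
proof -
  note add = additive_hbar_extend[OF additive_Delta]
  let ?d = mdegree
  have 1: "hDelta \<circ> (F \<star> G \<star> H) = star3 (\<lambda>a b c. hDelta (F a * G b * H c))"
    by (rule ext) (simp add: star_star_eq_star3 additive_star3[OF add])
  have 2: "(hDelta \<circ> (F \<star> G)) \<star> H = star3 (\<lambda>a b c. hDelta (F a * G b) * H c)"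
    by (rule star_left_eq_star3[OF add])
  have 3: "(hDelta \<circ> (G \<star> H)) \<star> F =
      star3 (\<lambda>a b c. signed (?d a * (?d b + ?d c)) (hDelta (G b * H c) * F a))"
    unfolding star_left_eq_star3[OF add]
    by (subst star3_swap23, subst star3_swap12) (simp add: algebra_simps)
  have 4: "(hDelta \<circ> (F \<star> H)) \<star> G =
      star3 (\<lambda>a b c. signed (?d b * ?d c) (hDelta (F a * H c) * G b))"
    unfolding star_left_eq_star3[OF add] by (rule star3_swap23)
  have 5: "(hDelta \<circ> F) \<star> G \<star> H = star3 (\<lambda>a b c. hDelta (F a) * G b * H c)"
    by (simp add: star_star_eq_star3)
  have 6: "(hDelta \<circ> G) \<star> F \<star> H =
      star3 (\<lambda>a b c. signed (?d a * ?d b) (hDelta (G b) * F a * H c))"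
    unfolding star_star_eq_star3 by (subst star3_swap12) simp
  have 7: "(hDelta \<circ> H) \<star> F \<star> G =
      star3 (\<lambda>a b c. signed ((?d a + ?d b) * ?d c) (hDelta (H c) * F a * G b))"
    unfolding star_star_eq_star3
    by (subst star3_swap12, subst star3_swap23) (simp add: algebra_simps)
  have "star3 (\<lambda>a b c. order_two_defect hDelta (?d a) (?d b) (?d c) (F a) (G b) (H c)) = star3 (\<lambda>a b c. 0)"
    using assms by (intro star3_cong hDelta_order_two_hbar_parity) (simp_all add: has_total_parity_def)
  also have "\<dots> = 0" by (rule ext) (simp add: star3_def)
  finally show ?thesis
    unfolding order_two_defect_def star3_add star3_diff
    unfolding 1 2 3 4 5 6 7 by (simp add: algebra_simps)
qed

end

section \<open>The master equation for even series\<close>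

context coordinates
begin

lemma parity_inv_hbar_parity: "has_hbar_parity p x \<Longrightarrow> hbar_extend parity_inv x = signed p x"
  by (rule fps_ext) (auto simp: has_hbar_parity_def signed_def parity_inv_has_parity[of p])

text \<open>
  In the bracket of an even series \<open>F\<close> with itself every product has \<open>F\<close> as one of its factors. In
  terms of \<open>\<star>\<close> both \<open>\<Delta>(F) F\<close> and \<open>F \<Delta>(F)\<close> become the product with \<open>\<Delta>(F)\<close> on the left.
\<close>

lemma series_mult_even_right:
  assumes "has_total_parity 0 F"
  shows "series_mult B r G F = G \<star> F"
proof (rule ext)
  fix m
  have "signed (inversions r a b) (G a * (if even (mdegree a) then F b else hbar_extend parity_inv (F b)))
      = signed (inversions r b a) (G a * F b)" if "m \<in> M" "(a, b) \<in> splits2 m" for a b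
  proof -
    have "hbar_extend parity_inv (F b) = signed (mdegree b) (F b)"
      using assms by (intro parity_inv_hbar_parity) (simp add: has_total_parity_def)
    then have "(if even (mdegree a) then F b else hbar_extend parity_inv (F b))
        = signed (mdegree a * mdegree b) (F b)"
      by (simp add: signed_def)
    then show ?thesis
      using even_inversions_swap[of a b] that
      by (auto simp: splits2_def signed_mult_right intro!: signed_cong)
  qed
  then show "series_mult B r G F m = (G \<star> F) m"
    unfolding series_mult_def star_def
    by (auto simp: sum_submultisets[of "\<lambda>a b. signed (inversions r a b)
      (G a * (if even (mdegree a) then F b else hbar_extend parity_inv (F b)))"] intro!: sum.cong)
qed

lemma series_mult_even_left:
  assumes F: "has_total_parity 0 F" and G: "has_total_parity q G"
  shows "series_mult B r F G = G \<star> F"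
proof (rule ext)
  fix m
  have "signed (inversions r a b) (F a * (if even (mdegree a) then G b else hbar_extend parity_inv (G b)))
      = signed (inversions r a b) (G b * F a)" for a b
  proof -
    have "hbar_extend parity_inv (G b) = signed (q + mdegree b) (G b)"
      using G by (intro parity_inv_hbar_parity) (simp add: has_total_parity_def)
    then have "(if even (mdegree a) then G b else hbar_extend parity_inv (G b))
        = signed (mdegree a * (q + mdegree b)) (G b)"
      by (simp add: signed_def)
    moreover have "F a * G b = signed (mdegree a * (q + mdegree b)) (G b * F a)"
      using F G by (intro hbar_parity_mult_swap) (simp_all add: has_total_parity_def)
    ultimately show ?thesis
      by (simp only: signed_mult_right signed_signed) (auto intro!: signed_cong)
  qed
  then have "series_mult B r F G m =
      (if m \<in> M then \<Sum>(a, b)\<in>splits2 m. signed (inversions r a b) (G b * F a) else 0)"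
    unfolding series_mult_def
    by (simp add: sum_submultisets[of "\<lambda>a b. signed (inversions r a b) (G b * F a)"])
  also have "\<dots> = (G \<star> F) m"
    by (subst sum_splits2_swap) (simp add: star_def)
  finally show "series_mult B r F G m = (G \<star> F) m" .
qed

definition bracket :: "('v set multiset \<Rightarrow> 'v fps) \<Rightarrow> 'v set multiset \<Rightarrow> 'v fps" where
  "bracket F = (hDelta \<circ> (F \<star> F)) - (hDelta \<circ> F) \<star> F - (hDelta \<circ> F) \<star> F"

lemma series_bracket_eq:
  assumes F: "has_total_parity 0 F"
  shows "series_bracket B r F F = bracket F"
proof -
  have "series_parity_inv F = F"
  proof (rule ext)
    fix m
    have "hbar_extend parity_inv (F m) = signed (mdegree m) (F m)"
      using F by (intro parity_inv_hbar_parity) (simp add: has_total_parity_def)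
    then show "series_parity_inv F m = F m"
      by (simp add: series_parity_inv_def signed_def)
  qed
  moreover have "has_total_parity (0 + 1) (hDelta \<circ> F)" by (rule total_parity_hDelta[OF F])
  ultimately show ?thesis
    unfolding series_bracket_def bracket_def
    by (auto simp: series_mult_even_right[OF F] series_mult_even_left[OF F])
qed

definition master_defect :: "('v set multiset \<Rightarrow> 'v fps) \<Rightarrow> 'v set multiset \<Rightarrow> 'v fps" where
  "master_defect F = (K \<circ> F) + (hscale (1 / 2) \<circ> bracket F)"

lemma quantum_master_equation_iff: "has_total_parity 0 F \<Longrightarrow> quantum_master_equation B r F \<longleftrightarrow> (\<forall>m. master_defect F m = 0)"
  by (simp add: quantum_master_equation_def master_defect_def series_bracket_eq)

lemma total_parity_bracket:
  assumes "has_total_parity 0 F"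
  shows "has_total_parity 1 (bracket F)"
proof -
  have "has_total_parity 1 (hDelta \<circ> (F \<star> F))" "has_total_parity 1 ((hDelta \<circ> F) \<star> F)"
    using total_parity_hDelta[OF total_parity_star[OF assms assms]] total_parity_star[OF total_parity_hDelta[OF assms] assms] by simp_all
  then show ?thesis by (simp add: has_total_parity_def bracket_def hbar_parity_diff)
qed

section \<open>Powers of an even series\<close>

text \<open>\<open>rpow F i G\<close> is \<open>G \<star> F\<^sup>i\<close>, so that \<open>F\<^sup>i\<^sup>+\<^sup>1\<close> is \<open>rpow F i F\<close>.\<close>

definition rpow :: "('v set multiset \<Rightarrow> 'v fps) \<Rightarrow> nat \<Rightarrow> ('v set multiset \<Rightarrow> 'v fps) \<Rightarrow>
    'v set multiset \<Rightarrow> 'v fps" where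
  "rpow F i = (\<lambda>G. G \<star> F) ^^ i"

lemma rpow_0 [simp]: "rpow F 0 G = G"
  by (simp add: rpow_def)

lemma rpow_Suc: "rpow F (Suc i) G = rpow F i G \<star> F"
  by (simp add: rpow_def)

lemma rpow_add: "rpow F i (G + H) = rpow F i G + rpow F i H"
  by (induction i) (simp_all only: rpow_0 rpow_Suc star_add_left)

lemma rpow_diff: "rpow F i (G - H) = rpow F i G - rpow F i H"
  by (induction i) (simp_all only: rpow_0 rpow_Suc star_diff_left)

lemma rpow_hscale: "rpow F i (hscale c \<circ> G) = hscale c \<circ> rpow F i G"
  by (induction i) (simp_all only: rpow_0 rpow_Suc star_hscale)

lemma hscale_add: "hscale (c + d) \<circ> G = (hscale c \<circ> G) + (hscale d \<circ> G)"
  by (rule ext) (simp add: fps_eq_iff scale_left_distrib)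

lemma hscale_1: "hscale 1 \<circ> G = G"
  by (rule ext) (simp add: fps_eq_iff)

lemma star_rpow: "G \<star> rpow F i F = rpow F (Suc i) G"
  by (induction i) (simp_all add: rpow_Suc star_assoc)

lemma total_parity_rpow: "has_total_parity 0 F \<Longrightarrow> has_total_parity 0 (rpow F i F)"
  using total_parity_star[of 0 _ 0 F] by (induction i) (simp_all add: rpow_Suc)

lemma hQ_rpow:
  assumes "has_total_parity 0 F"
  shows "hQ \<circ> rpow F (Suc i) F = (hQ \<circ> rpow F i F) \<star> F + rpow F (Suc i) (hQ \<circ> F)"
  using hQ_star[OF total_parity_rpow[OF assms] assms, of i] star_rpow[of "hQ \<circ> F" F i]
  by (simp add: rpow_Suc)

text \<open>
  \<open>\<Delta>(F\<^sup>i\<^sup>+\<^sup>2) = \<Delta>(F\<^sup>i\<^sup>+\<^sup>1) F + \<Delta>(F) F\<^sup>i\<^sup>+\<^sup>1 + (i + 1) [F, F] F\<^sup>i\<close>, by induction: the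
  step applies the seven-term identity to \<open>F\<^sup>i\<^sup>+\<^sup>1, F, F\<close>.
\<close>

lemma hDelta_rpow:
  assumes F: "has_total_parity 0 F"
  shows "hDelta \<circ> rpow F (Suc i) F =
    (hDelta \<circ> rpow F i F) \<star> F + rpow F (Suc i) (hDelta \<circ> F)
    + (hscale (of_nat (Suc i)) \<circ> rpow F i (bracket F))"
proof (induction i)
  case 0
  have "of_nat (Suc 0) = (1 :: 'k)" by simp
  then show ?case
    by (simp only: rpow_Suc rpow_0 hscale_1 bracket_def diff_diff_eq add_diff_eq add_diff_cancel_left')
next
  case (Suc i)
  have c: "(of_nat (Suc (Suc i)) :: 'k) = of_nat (Suc i) + 1" by simp
  let ?P = "rpow F i F" and ?D = "hDelta \<circ> F"
  have "?D \<star> F \<star> ?P = ?D \<star> ?P \<star> F"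
    using star_commute[OF F total_parity_rpow[OF F]] by (simp flip: star_assoc)
  then have "rpow F (Suc i) (bracket F) = (hDelta \<circ> (F \<star> F)) \<star> ?P - ?D \<star> ?P \<star> F - ?D \<star> ?P \<star> F"
    unfolding star_rpow[symmetric] by (simp add: bracket_def star_diff_left)
  moreover have "hDelta \<circ> rpow F (Suc (Suc i)) F =
      (hDelta \<circ> (?P \<star> F)) \<star> F + (hDelta \<circ> (F \<star> F)) \<star> ?P + (hDelta \<circ> (?P \<star> F)) \<star> F
      - (hDelta \<circ> ?P) \<star> F \<star> F - ?D \<star> ?P \<star> F - ?D \<star> ?P \<star> F"
    unfolding rpow_Suc by (rule hDelta_star_star[OF total_parity_rpow[OF F] F F])
  ultimately have "hDelta \<circ> rpow F (Suc (Suc i)) F =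
      (hDelta \<circ> rpow F (Suc i) F) \<star> F
      + ((hDelta \<circ> rpow F (Suc i) F) - (hDelta \<circ> rpow F i F) \<star> F) \<star> F + rpow F (Suc i) (bracket F)"
    by (simp add: rpow_Suc star_diff_left)
  also have "(hDelta \<circ> rpow F (Suc i) F) - (hDelta \<circ> rpow F i F) \<star> F =
      rpow F (Suc i) ?D + (hscale (of_nat (Suc i)) \<circ> rpow F i (bracket F))"
    unfolding Suc.IH by simp
  also have "\<dots> \<star> F = rpow F (Suc (Suc i)) ?D + (hscale (of_nat (Suc i)) \<circ> rpow F (Suc i) (bracket F))"
    by (simp add: rpow_Suc star_add_left star_hscale)
  also have "(hDelta \<circ> rpow F (Suc i) F) \<star> F + (rpow F (Suc (Suc i)) ?D
      + (hscale (of_nat (Suc i)) \<circ> rpow F (Suc i) (bracket F))) + rpow F (Suc i) (bracket F)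
    = (hDelta \<circ> rpow F (Suc i) F) \<star> F + rpow F (Suc (Suc i)) ?D
      + (hscale (of_nat (Suc (Suc i))) \<circ> rpow F (Suc i) (bracket F))"
    unfolding c hscale_add hscale_1 by (simp only: ac_simps)
  finally show ?case .
qed

lemma K_comp: "K \<circ> F = (hQ \<circ> F) + (hbar_times \<circ> (hDelta \<circ> F))"
  by (auto simp: K_def)

lemma K_rpow_step:
  assumes "has_total_parity 0 F"
  shows "K \<circ> rpow F (Suc i) F = (K \<circ> rpow F i F) \<star> F + rpow F (Suc i) (K \<circ> F)
    + (hscale (of_nat (Suc i)) \<circ> (hbar_times \<circ> rpow F i (bracket F)))"
proof -
  have rpow_hbar: "rpow F i (hbar_times \<circ> G) = hbar_times \<circ> rpow F i G" for i G
    by (induction i) (simp_all only: rpow_0 rpow_Suc star_hbar_times)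
  show ?thesis
    unfolding K_comp hQ_rpow[OF assms] hDelta_rpow[OF assms]
    by (rule ext)
      (simp add: rpow_add rpow_hbar star_add_left star_hbar_times additive.add[OF additive_hbar_times]
        fps_eq_iff hbar_times_nth)
qed

text \<open>
  The identity \<open>K(exp(F/\<hbar>)) = \<hbar>\<^sup>-\<^sup>1 (K F + [F, F]/2) exp(F/\<hbar>)\<close>, separately for each power of \<open>F\<close> and
  without denominators in \<open>\<hbar>\<close>.
\<close>

lemma K_rpow:
  assumes "has_total_parity 0 F"
  shows "K \<circ> rpow F (Suc i) F = (hscale (of_nat (i + 2)) \<circ> rpow F (Suc i) (K \<circ> F))
    + (hscale (of_nat ((i + 1) * (i + 2)) / 2) \<circ> (hbar_times \<circ> rpow F i (bracket F)))"
proof (induction i)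
  case 0
  have "hscale (of_nat (0 + 2)) \<circ> G = G + G"
    for G :: "'v set multiset \<Rightarrow> 'v fps"
    using hscale_add[of 1 1 G] by (simp add: hscale_1)
  moreover have "of_nat ((0 + 1) * (0 + 2)) / 2 = (1 :: 'k)" "of_nat (Suc 0) = (1 :: 'k)" by simp_all
  ultimately show ?case
    using K_rpow_step[OF assms, of 0] by (simp only: rpow_Suc rpow_0 hscale_1)
next
  case (Suc i)
  have c: "(of_nat ((Suc i + 1) * (Suc i + 2)) / 2 :: 'k) = of_nat ((i + 1) * (i + 2)) / 2 + of_nat (Suc (Suc i))"
    and d: "(of_nat (Suc i + 2) :: 'k) = of_nat (i + 2) + 1"
    by (simp_all add: field_simps)
  have "K \<circ> rpow F (Suc (Suc i)) F =
      (hscale (of_nat (i + 2)) \<circ> rpow F (Suc (Suc i)) (K \<circ> F))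
      + (hscale (of_nat ((i + 1) * (i + 2)) / 2) \<circ> (hbar_times \<circ> rpow F (Suc i) (bracket F)))
      + rpow F (Suc (Suc i)) (K \<circ> F)
      + (hscale (of_nat (Suc (Suc i))) \<circ> (hbar_times \<circ> rpow F (Suc i) (bracket F)))"
    unfolding K_rpow_step[OF assms, of "Suc i"] Suc.IH
    by (simp only: star_add_left star_hscale star_hbar_times rpow_Suc[symmetric])
  then show ?case
    unfolding c d hscale_add hscale_1 by (simp only: ac_simps)
qed

section \<open>Vanishing of low-order terms\<close>

definition vanishes_below :: "nat \<Rightarrow> ('v set multiset \<Rightarrow> 'v fps) \<Rightarrow> bool" where
  "vanishes_below n F \<longleftrightarrow> (\<forall>m. size m < n \<longrightarrow> F m = 0)"

lemma vanishes_below_1: "vanishes_below (Suc 0) F \<longleftrightarrow> F {#} = 0"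
  by (auto simp: vanishes_below_def)

lemma vanishes_below_star:
  assumes "vanishes_below i F" "vanishes_below j G"
  shows "vanishes_below (i + j) (F \<star> G)"
  unfolding vanishes_below_def
proof (intro allI impI)
  fix m :: "'v set multiset" assume m: "size m < i + j"
  have "F a * G b = 0" if "(a, b) \<in> splits2 m" for a b
  proof -
    have "size a < i \<or> size b < j" using m that by (auto simp: splits2_def)
    then show ?thesis using assms by (auto simp: vanishes_below_def)
  qed
  then have "(\<Sum>(a, b)\<in>splits2 m. signed (inversions r b a) (F a * G b)) = 0"
    by (intro sum.neutral) auto
  then show "(F \<star> G) m = 0" by (simp add: star_def)
qed

lemma vanishes_below_rpow:
  assumes "vanishes_below (Suc 0) F" "vanishes_below j G"
  shows "vanishes_below (j + i) (rpow F i G)"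
proof (induction i)
  case (Suc i)
  from vanishes_below_star[OF Suc.IH assms(1)] show ?case by (simp add: rpow_Suc)
qed (simp add: assms)

lemma vanishes_below_bracket:
  assumes "vanishes_below (Suc 0) F"
  shows "vanishes_below 2 (bracket F)"
proof -
  have "vanishes_below (Suc 0) (hDelta \<circ> F)"
    using assms additive.zero[OF additive_hbar_extend[OF additive_Delta]]
    by (simp add: vanishes_below_def)
  then have "vanishes_below 2 ((hDelta \<circ> F) \<star> F)" "vanishes_below 2 (F \<star> F)"
    using vanishes_below_star[of "Suc 0" _ "Suc 0" F] assms by (simp_all add: numeral_2_eq_2)
  then show ?thesis
    using additive.zero[OF additive_hbar_extend[OF additive_Delta]]
    by (simp add: vanishes_below_def bracket_def)
qed

text \<open>
  For series without constant term the coefficient of a product at \<open>m\<close> involves only proper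
  divisors of \<open>m\<close>. This is what allows the master equation to be solved order by order.
\<close>

lemma star_cong_below:
  assumes "vanishes_below (Suc 0) F" "vanishes_below (Suc 0) F'" "vanishes_below (Suc 0) G" "vanishes_below (Suc 0) G'"
    and "\<And>a. a \<subset># m \<Longrightarrow> F a = F' a" "\<And>a. a \<subset># m \<Longrightarrow> G a = G' a"
  shows "(F \<star> G) m = (F' \<star> G') m"
proof -
  have "F a * G b = F' a * G' b" if "(a, b) \<in> splits2 m" for a b
  proof (cases "a = {#} \<or> b = {#}")
    case True
    then show ?thesis using assms(1-4) by (auto simp: vanishes_below_1)
  next
    case False
    with that have "a \<subset># m" "b \<subset># m"
      by (auto simp: splits2_def subset_mset.less_le)
    then show ?thesis by (simp add: assms(5,6))
  qed
  then show ?thesis by (auto simp: star_def intro!: sum.cong)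
qed

lemma bracket_cong_below:
  assumes "F {#} = 0" "F' {#} = 0" "\<And>a. a \<subset># m \<Longrightarrow> F a = F' a"
  shows "bracket F m = bracket F' m"
proof -
  have "vanishes_below (Suc 0) F" "vanishes_below (Suc 0) F'"
    "vanishes_below (Suc 0) (hDelta \<circ> F)" "vanishes_below (Suc 0) (hDelta \<circ> F')"
    using assms additive.zero[OF additive_hbar_extend[OF additive_Delta]]
    by (simp_all add: vanishes_below_1)
  then have "(F \<star> F) m = (F' \<star> F') m" "((hDelta \<circ> F) \<star> F) m = ((hDelta \<circ> F') \<star> F') m"
    using assms(3) by (auto intro!: star_cong_below)
  then show ?thesis by (simp add: bracket_def)
qed

lemma bracket_outside: "m \<notin> M \<Longrightarrow> bracket F m = 0"
  using additive.zero[OF additive_hbar_extend[OF additive_Delta]]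
  by (simp add: bracket_def star_outside)

section \<open>Solving the master equation order by order\<close>

lemma range_K_add: "x \<in> range K \<Longrightarrow> y \<in> range K \<Longrightarrow> x + y \<in> range K"
  by (elim rangeE) (simp flip: K_add)

lemma range_K_hscale: "x \<in> range K \<Longrightarrow> hscale c x \<in> range K"
  by (elim rangeE) (simp flip: K_hscale)

text \<open>
  Let the master equation hold below the order of \<open>m\<close>. Then at \<open>m\<close> one may replace \<open>K F\<close> by
  \<open>-[F, F]/2\<close> in the formula for \<open>K(F\<^sup>i\<^sup>+\<^sup>2)\<close>, which says that \<open>\<hbar> [F, F] F\<^sup>i\<close> is a multiple of
  \<open>[F, F] F\<^sup>i\<^sup>+\<^sup>1\<close> modulo the image of \<open>K\<close>. For large \<open>i\<close> the latter has no term at \<open>m\<close>; since the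
  cohomology of \<open>K\<close> is torsion-free, \<open>[F, F] F\<^sup>i\<close> is exact at \<open>m\<close> for all \<open>i\<close> by descending induction.
\<close>

lemma obstruction_exact:
  assumes lift: cocycles_lift and F: "has_total_parity 0 F" "F {#} = 0"
    and master_defect: "vanishes_below (size m) (master_defect F)"
  shows "bracket F m \<in> range K"
proof -
  have F1: "vanishes_below (Suc 0) F" using F(2) by (simp add: vanishes_below_1)
  have "rpow F i (bracket F) m \<in> range K" if "size m \<le> i + d" for i d
    using that
  proof (induction d arbitrary: i)
    case 0
    then have "rpow F i (bracket F) m = 0"
      using vanishes_below_rpow[OF F1 vanishes_below_bracket[OF F1], of i]
      by (simp add: vanishes_below_def)
    then show ?case by (metis K_0 rangeI)
  next
    case (Suc d)
    define c :: 'k where "c = of_nat ((i + 1) * (i + 2)) / 2"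
    have c: "c \<noteq> 0" by (simp add: c_def del: of_nat_mult of_nat_add of_nat_Suc)
    let ?b = "rpow F (Suc i) (bracket F) m"
    have b: "?b \<in> range K" using Suc.prems by (intro Suc.IH) simp
    have "K \<circ> F = master_defect F - (hscale (1 / 2) \<circ> bracket F)" by (simp add: master_defect_def)
    then have "rpow F (Suc i) (K \<circ> F) m = rpow F (Suc i) (master_defect F) m - hscale (1 / 2) ?b"
      by (simp add: rpow_diff rpow_hscale)
    moreover have "rpow F (Suc i) (master_defect F) m = 0"
      using vanishes_below_rpow[OF F1 master_defect, of "Suc i"] by (simp add: vanishes_below_def)
    ultimately have "K (rpow F (Suc i) F m)
        = hscale (of_nat (i + 2)) (- hscale (1 / 2) ?b) + hscale c (hbar_times (rpow F i (bracket F) m))"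
      using fun_cong[OF K_rpow[OF F(1), of i], of m] by (simp add: c_def)
    then have "hbar_times (rpow F i (bracket F) m)
        = hscale (1 / c) (K (rpow F (Suc i) F m) + hscale (of_nat (i + 2) / 2) ?b)"
      using c by (simp add: fps_eq_iff scale_right_distrib)
    also have "\<dots> \<in> range K" by (intro range_K_hscale range_K_add b rangeI)
    finally show ?case by (rule exact_of_hbar_times_exact[OF lift])
  qed
  from this[of 0 "size m"] show ?thesis by simp
qed

text \<open>
  At each order the obstruction \<open>[F, F]\<close> is \<open>K z\<close> for some \<open>z\<close> that may be chosen with the right
  parity, and the coefficient \<open>-z/2\<close> solves the equation there without affecting lower orders. The
  linear part is never changed because the induction starts from it.
\<close>

lemma versal_series_exists:
  assumes lift: cocycles_lift
    and \<gamma>: "\<And>X. X \<in> B \<Longrightarrow> K (\<gamma> X) = 0" "\<And>X. X \<in> B \<Longrightarrow> has_hbar_parity (mdegree {#X#}) (\<gamma> X)"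
  obtains \<Gamma> where "\<Gamma> \<in> series B" "has_total_parity 0 \<Gamma>" "\<Gamma> {#} = 0" "\<And>m. master_defect \<Gamma> m = 0"
    "\<And>X. X \<in> B \<Longrightarrow> \<Gamma> {#X#} = \<gamma> X"
proof -
  let ?S = "\<lambda>G. G \<in> series B \<and> has_total_parity 0 G \<and> G {#} = 0 \<and> (\<forall>X\<in>B. G {#X#} = \<gamma> X)"
  \<comment> \<open>Stage \<open>n\<close> solves the equation for monomials of size at most \<open>n + 1\<close>: the linear part alone
    already does so for \<open>n = 0\<close>.\<close>
  let ?P = "\<lambda>n G. ?S G \<and> vanishes_below (Suc (Suc n)) (master_defect G)"
  let ?R = "\<lambda>n G G'. \<forall>m. size m \<le> Suc n \<longrightarrow> (G' m :: 'v fps) = G m"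
  have "\<exists>f. \<forall>n. ?P n (f n) \<and> ?R n (f n) (f (Suc n))"
  proof (rule dependent_nat_choice)
    define G where "G = (\<lambda>m. if m \<in> M \<and> size m = 1 then \<gamma> (THE X. m = {#X#}) else 0)"
    have single: "{#X#} \<in> M \<longleftrightarrow> X \<in> B" for X by (auto simp: monomials_def)
    have G: "G {#X#} = (if X \<in> B then \<gamma> X else 0)" for X by (simp add: G_def single)
    have zero: "G m = 0" if "size m \<noteq> 1" for m using that by (simp add: G_def)
    have "has_total_parity 0 G"
      unfolding has_total_parity_def
    proof
      fix m
      show "has_hbar_parity (0 + mdegree m) (G m)"
      proof (cases "size m = 1")
        case True
        then obtain X where "m = {#X#}" using size_1_singleton_mset by blast
        then show ?thesis by (simp add: G \<gamma>(2))
      qed (simp add: zero)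
    qed
    moreover have "master_defect G m = 0" if m: "size m < 2" for m
    proof -
      have "bracket G m = 0"
        using m vanishes_below_bracket[of G] zero[of "{#}"]
        by (simp add: vanishes_below_1) (simp add: vanishes_below_def)
      moreover have "K (G m) = 0"
      proof (cases "size m = 1")
        case True
        then obtain X where "m = {#X#}" using size_1_singleton_mset by blast
        then show ?thesis by (simp add: G \<gamma>(1))
      qed (simp add: zero)
      ultimately show ?thesis by (simp add: master_defect_def fps_eq_iff)
    qed
    moreover have "G \<in> series B" by (simp add: series_def G_def)
    ultimately have "?P 0 G" using G zero by (simp add: vanishes_below_def)
    then show "\<exists>G. ?P 0 G" by (rule exI[where P = "?P 0"])
  next
    fix G n assume P: "?P n G"
    let ?n = "Suc (Suc n)"
    have "\<exists>z. K z = bracket G m \<and> has_hbar_parity (mdegree m) z" if m: "size m = ?n" for m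
    proof -
      obtain x where "K x = bracket G m"
        using obstruction_exact[OF lift, of G m] P m by fastforce
      moreover have "has_hbar_parity (mdegree m + 1) (bracket G m)"
        using total_parity_bracket[of G] P by (simp add: has_total_parity_def add.commute)
      ultimately show ?thesis by (metis hbar_parity_primitive)
    qed
    then obtain z where z: "\<And>m. size m = ?n \<Longrightarrow> K (z m) = bracket G m"
      "\<And>m. size m = ?n \<Longrightarrow> has_hbar_parity (mdegree m) (z m)"
      by metis
    define G' where "G' = (\<lambda>m. if m \<in> M \<and> size m = ?n then hscale (- (1 / 2)) (z m) else G m)"
    have agree: "G' m = G m" if "size m < ?n" for m using that by (simp add: G'_def)
    have "?S G'"
      using P z(2) by (auto simp: G'_def series_def has_total_parity_def hbar_parity_hscale)
    moreover have "master_defect G' m = 0" if m: "size m < Suc ?n" for m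
    proof -
      have "bracket G' m = bracket G m"
      proof (rule bracket_cong_below)
        fix a assume "a \<subset># m"
        then have "size a < size m" by (rule mset_subset_size)
        with m show "G' a = G a" by (intro agree) simp
      qed (use P \<open>?S G'\<close> in auto)
      show ?thesis
      proof (cases "size m < ?n")
        case True
        have "master_defect G m = 0" using P True by (simp add: vanishes_below_def)
        with \<open>bracket G' m = bracket G m\<close> agree[OF True] show ?thesis by (simp add: master_defect_def)
      next
        case False
        with m have m: "size m = ?n" by simp
        show ?thesis
        proof (cases "m \<in> M")
          case True
          have "K (G' m) = hscale (- (1 / 2)) (bracket G m)"
            using True m by (simp add: G'_def K_hscale z(1))
          then show ?thesis
            unfolding master_defect_def using \<open>bracket G' m = bracket G m\<close> by (simp add: fps_eq_iff)
        next
          case False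
          then have "G m = 0" using P by (simp add: series_def)
          with False show ?thesis by (simp add: master_defect_def G'_def bracket_outside additive.zero[OF additive_hscale])
        qed
      qed
    qed
    moreover have "?R n G G'" using agree by simp
    ultimately have "?P (Suc n) G' \<and> ?R n G G'" by (simp add: vanishes_below_def)
    then show "\<exists>G'. ?P (Suc n) G' \<and> ?R n G G'"
      by (rule exI[where P = "\<lambda>G'. ?P (Suc n) G' \<and> ?R n G G'"])
  qed
  then obtain f where f: "\<And>n. ?P n (f n)" and step: "\<And>n. ?R n (f n) (f (Suc n))" by blast
  define \<Gamma> where "\<Gamma> m = f (size m) m" for m
  have stable: "\<Gamma> a = f n a" if "size a \<le> n" for a n
    unfolding \<Gamma>_def using that by (induction rule: dec_induct) (use step in auto)
  have S: "?S (f n)" for n using f by blast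
  show ?thesis
  proof (rule that)
    show "\<Gamma> \<in> series B" "has_total_parity 0 \<Gamma>" "\<Gamma> {#} = 0"
      using S by (auto simp: \<Gamma>_def series_def has_total_parity_def)
    show "\<Gamma> {#X#} = \<gamma> X" if "X \<in> B" for X
      using S that by (simp add: \<Gamma>_def)
    fix m
    have "bracket \<Gamma> m = bracket (f (size m)) m"
    proof (rule bracket_cong_below)
      fix a assume "a \<subset># m"
      then show "\<Gamma> a = f (size m) a"
        using mset_subset_size[of a m] by (intro stable) simp
    qed (use S in \<open>auto simp: \<Gamma>_def\<close>)
    then have "master_defect \<Gamma> m = master_defect (f (size m)) m" by (simp add: master_defect_def \<Gamma>_def)
    also have "\<dots> = 0" using f[of "size m"] by (simp add: vanishes_below_def)
    finally show "master_defect \<Gamma> m = 0" .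
  qed
qed

end

section \<open>Homogeneous bases of the cohomology\<close>

context differential_BV_algebra
begin

lemma subspace_range_Q: "subspace (range Q)"
  unfolding subspace_def
  by (auto simp flip: Q_add Q_scale intro: range_eqI[of _ _ 0])

lemmas range_Q_add = subspace_add[OF subspace_range_Q]
  and range_Q_diff = subspace_diff[OF subspace_range_Q]
  and range_Q_scale = subspace_scale[OF subspace_range_Q]
  and range_Q_sum = subspace_sum[OF subspace_range_Q]

lemma cohomologous_Image: "Q w = 0 \<Longrightarrow> cohomologous `` {w} = {v. v - w \<in> range Q}"
proof (intro set_eqI iffI)
  fix v assume w: "Q w = 0"
  { assume "v \<in> cohomologous `` {w}"
    then have "w - v \<in> range Q" by (simp add: cohomologous_def)
    from range_Q_diff[OF subspace_0[OF subspace_range_Q] this] have "0 - (w - v) \<in> range Q" .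
    then show "v \<in> {v. v - w \<in> range Q}" by simp }
  { assume "v \<in> {v. v - w \<in> range Q}"
    then have v: "v - w \<in> range Q" by simp
    then have "Q (v - w) = 0" using Q_square by auto
    moreover have "0 - (v - w) \<in> range Q"
      by (rule range_Q_diff[OF subspace_0[OF subspace_range_Q] v])
    ultimately show "v \<in> cohomologous `` {w}" using w by (simp add: cohomologous_def Q_diff) }
qed

lemma cohomology_class:
  assumes "X \<in> cohomology" "x \<in> X"
  shows "Q x = 0" "X = cohomologous `` {x}"
proof -
  obtain w where w: "Q w = 0" "X = cohomologous `` {w}"
    using assms(1) by (auto simp: cohomology_def quotient_def)
  with assms(2) have xw: "x - w \<in> range Q" by (simp add: cohomologous_Image)
  then have "Q (x - w) = 0" using Q_square by auto
  with w show "Q x = 0" by (simp add: Q_diff)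
  moreover have "v - w \<in> range Q \<longleftrightarrow> v - x \<in> range Q" for v
    using range_Q_diff[OF _ xw, of "v - w"] range_Q_add[OF _ xw, of "v - x"] by auto
  ultimately show "X = cohomologous `` {x}" using w by (simp add: cohomologous_Image)
qed

text \<open>
  Changing the representatives changes the sum by an element of \<open>im Q\<close>.
\<close>

lemma class_comb_eq:
  assumes A: "finite A" "A \<subseteq> cohomology" and s: "\<And>X. X \<in> A \<Longrightarrow> s X \<in> X"
  shows "class_comb A c = cohomologous `` {\<Sum>X\<in>A. scale (c X) (s X)}"
proof -
  let ?t = "\<lambda>x. \<Sum>X\<in>A. scale (c X) (x X)"
  have Qs: "Q (s X) = 0" if "X \<in> A" for X
    using cohomology_class(1) A(2) s that by blast
  then have "Q (?t s) = 0" by (simp add: Q_sum Q_scale)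
  have diff: "?t x - ?t s \<in> range Q" if "\<forall>X\<in>A. x X \<in> X" for x
  proof -
    have "x X - s X \<in> range Q" if "X \<in> A" for X
    proof -
      have "X = {v. v - s X \<in> range Q}"
        using cohomology_class(2)[of X "s X"] A(2) s[OF that] that cohomologous_Image[OF Qs[OF that]]
        by blast
      then show ?thesis using \<open>\<forall>X\<in>A. x X \<in> X\<close> that by blast
    qed
    then have "(\<Sum>X\<in>A. scale (c X) (x X - s X)) \<in> range Q"
      by (intro range_Q_sum range_Q_scale)
    then show ?thesis by (simp add: scale_right_diff_distrib sum_subtractf)
  qed
  have "v \<in> class_comb A c \<longleftrightarrow> v - ?t s \<in> range Q" for v
  proof
    assume "v \<in> class_comb A c"
    then obtain x where x: "\<forall>X\<in>A. x X \<in> X" "v - ?t x \<in> range Q"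
      by (auto simp: class_comb_def)
    have "v - ?t s = (v - ?t x) + (?t x - ?t s)" by simp
    then show "v - ?t s \<in> range Q" using range_Q_add[OF x(2) diff[OF x(1)]] by simp
  next
    assume "v - ?t s \<in> range Q"
    with s show "v \<in> class_comb A c" unfolding class_comb_def by blast
  qed
  then show ?thesis
    using cohomologous_Image[OF \<open>Q (?t s) = 0\<close>] by blast
qed

lemma zero_class: "cohomologous `` {0} = range Q"
  by (simp add: cohomologous_Image)

lemma homogeneous_basisD:
  assumes "homogeneous_basis B"
  shows "B \<subseteq> cohomology" "\<forall>X\<in>B. \<exists>j. X \<inter> gr j \<noteq> {}"
    "\<forall>A c. finite A \<and> A \<subseteq> B \<and> class_comb A c = cohomologous `` {0} \<longrightarrow> (\<forall>X\<in>A. c X = 0)"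
    "\<forall>Y\<in>cohomology. \<exists>A c. finite A \<and> A \<subseteq> B \<and> Y = class_comb A c"
proof -
  note basis = assms[unfolded homogeneous_basis_def]
  show "B \<subseteq> cohomology"
    by (rule basis[THEN conjunct1])
  show "\<forall>X\<in>B. \<exists>j. X \<inter> gr j \<noteq> {}"
    by (rule basis[THEN conjunct2, THEN conjunct1])
  show "\<forall>A c. finite A \<and> A \<subseteq> B \<and> class_comb A c = cohomologous `` {0} \<longrightarrow> (\<forall>X\<in>A. c X = 0)"
    by (rule basis[THEN conjunct2, THEN conjunct2, THEN conjunct1])
  show "\<forall>Y\<in>cohomology. \<exists>A c. finite A \<and> A \<subseteq> B \<and> Y = class_comb A c"
    by (rule basis[THEN conjunct2, THEN conjunct2, THEN conjunct2])
qed

lemma basis_class_nonzero: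
  assumes B: "homogeneous_basis B" "X \<in> B" and x: "x \<in> X"
  shows "x \<notin> range Q"
proof
  assume "x \<in> range Q"
  have X: "X \<in> cohomology" using B homogeneous_basisD(1) by blast
  have "class_comb {X} (\<lambda>_. 1) = X"
    using class_comb_eq[of "{X}" "\<lambda>_. x" "\<lambda>_. 1"] X x cohomology_class(2)[OF X x] by simp
  also have "X = range Q"
    using cohomology_class[OF X x] \<open>x \<in> range Q\<close> cohomologous_Image[of x]
      range_Q_add[of _ x] range_Q_diff[of _ x]
    by (metis (no_types, lifting) Collect_cong Collect_mem_eq diff_add_cancel)
  finally have "(1 :: 'k) = 0"
    using homogeneous_basisD(3)[OF B(1), rule_format, of "{X}" "\<lambda>_. 1" X] B(2) zero_class by simp
  then show False by simp
qed

text \<open>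
  The parity of a nonzero class is well defined: an even and an odd representative would differ by a
  coboundary \<open>Q u\<close>, and splitting \<open>u\<close> by parity shows that both are coboundaries.
\<close>

lemma basis_class_parity:
  assumes B: "homogeneous_basis B" "X \<in> B" and x: "x \<in> X" "x \<in> gr j"
  shows "has_parity (mdegree {#X#}) x"
proof (cases "odd j")
  case True
  then have "odd_class X" using x by (auto simp: odd_class_def)
  with True x(2) show ?thesis by (intro gr_has_parity[of x j]) (simp_all add: mdegree_def)
next
  case even: False
  have "\<not> odd_class X"
  proof
    assume "odd_class X"
    then obtain i y where y: "odd i" "y \<in> X" "y \<in> gr i" by (auto simp: odd_class_def)
    have X: "X \<in> cohomology" using B homogeneous_basisD(1) by blast
    have "y - x \<in> range Q"
      using cohomology_class[OF X x(1)] y(2) cohomologous_Image[of x] by auto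
    then obtain u where "y - x = Q u" by blast
    moreover obtain a b where "has_parity 0 a" "has_parity (0 + 1) b" "u = a + b" by (rule has_parity_decompose)
    ultimately have ab: "y - Q a = x + Q b" "has_parity 1 (Q a)" "has_parity 2 (Q b)"
      using has_parity_Q[of 0 a] has_parity_Q[of 1 b] by (simp_all add: Q_add algebra_simps)
    have "has_parity 0 (x + Q b)"
      using ab(3) has_parity_cong[of 2 0] gr_has_parity[OF x(2), of 0] even by (auto intro: has_parity_add)
    moreover have "has_parity (0 + 1) (x + Q b)"
      unfolding ab(1)[symmetric] using ab(2) gr_has_parity[OF y(3), of 1] y(1) by (auto intro: has_parity_diff)
    ultimately have "x + Q b = 0" by (rule has_parity_both_eq_0)
    then have "x = Q (- b)" by (simp add: Q_minus eq_neg_iff_add_eq_0)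
    with basis_class_nonzero[OF B x(1)] show False by blast
  qed
  with even x(2) show ?thesis by (intro gr_has_parity[of x j]) (simp_all add: mdegree_def)
qed

lemma Q_component:
  assumes "Q v = 0"
  shows "Q (component v j) = 0"
proof -
  let ?J = "{j. component v j \<noteq> 0}"
  have "component (Q v) = (\<lambda>i. Q (component v (i - 1)))"
  proof (rule component_eqI)
    show "finite ((\<lambda>j. j + 1) ` ?J)" by (simp add: component_spec(2))
    show "Q (component v (i - 1)) = 0" if "i \<notin> (\<lambda>j. j + 1) ` ?J" for i
    proof -
      have "i - 1 \<notin> ?J" using that by (metis diff_add_cancel imageI)
      then show ?thesis by simp
    qed
    show "Q (component v (i - 1)) \<in> gr i" for i
      using Q_degree[OF component_spec(1)[of v "i - 1"]] by simp
    have "Q v = (\<Sum>j\<in>?J. Q (component v j))"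
      using arg_cong[OF component_spec(3)[of v], of Q] by (simp add: Q_sum)
    then show "Q v = (\<Sum>i\<in>(\<lambda>j. j + 1) ` ?J. Q (component v (i - 1)))"
      by (simp add: sum.reindex inj_on_def)
  qed
  then have "component (Q v) (j + 1) = Q (component v j)" by simp
  moreover have "component (Q v) (j + 1) = 0"
    using component_homogeneous[of 0 0] subspace_0[OF gr_subspace] assms by simp
  ultimately show ?thesis by simp
qed

text \<open>
  A basis of \<open>im Q\<close> extends by homogeneous cocycles to a set spanning all cocycles; the classes of
  the added cocycles form a basis of the cohomology.
\<close>

lemma homogeneous_basis_exists: "\<exists>B. homogeneous_basis B"
proof -
  obtain I where I: "I \<subseteq> range Q" "independent I" "range Q \<subseteq> span I"
    by (rule maximal_independent_subset)
  let ?H = "{x. Q x = 0 \<and> (\<exists>j. x \<in> gr j)}"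
  obtain C where C: "I \<subseteq> C" "C \<subseteq> I \<union> ?H" "independent C" "I \<union> ?H \<subseteq> span C"
    by (rule maximal_independent_subset_extend[of I "I \<union> ?H"]) (use I in auto)
  define S where "S = C - I"
  define cl where "cl s = cohomologous `` {s}" for s
  have S: "Q s = 0" "\<exists>j. s \<in> gr j" if "s \<in> S" for s
    using that C(2) by (auto simp: S_def)
  have cl: "cl s = {v. v - s \<in> range Q}" if "Q s = 0" for s
    using that by (simp add: cl_def cohomologous_Image)
  have self: "s \<in> cl s" if "Q s = 0" for s
    using that subspace_0[OF subspace_range_Q] by (simp add: cl)
  have indep: "c s = 0"
    if A: "finite A" "A \<subseteq> S" and sum: "(\<Sum>s\<in>A. scale (c s) s) \<in> range Q" and s: "s \<in> A" for A c s
  proof (rule ccontr)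
    assume "c s \<noteq> 0"
    let ?W = "span (C - {s})"
    have "(\<Sum>s\<in>A. scale (c s) s) \<in> ?W"
      using sum I(3) span_mono[of I "C - {s}"] C(1) s A(2) by (auto simp: S_def)
    moreover have "(\<Sum>x\<in>A - {s}. scale (c x) x) \<in> ?W"
      using A(2) by (intro span_sum span_scale span_base) (auto simp: S_def)
    ultimately have "(\<Sum>s\<in>A. scale (c s) s) - (\<Sum>x\<in>A - {s}. scale (c x) x) \<in> ?W"
      by (rule span_diff)
    then have "scale (c s) s \<in> ?W"
      using sum.remove[OF A(1) s, of "\<lambda>x. scale (c x) x"] by simp
    from span_scale[OF this, of "1 / c s"] have "s \<in> ?W" using \<open>c s \<noteq> 0\<close> by simp
    then show False
      using C(3) s A(2) unfolding dependent_def by (auto simp: S_def)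
  qed
  have inj: "inj_on cl S"
  proof (rule inj_onI, rule ccontr)
    fix s s' assume *: "s \<in> S" "s' \<in> S" "cl s = cl s'" "s \<noteq> s'"
    then have "s - s' \<in> range Q" using self[of s] S cl by auto
    then have "(\<Sum>x\<in>{s, s'}. scale (if x = s then 1 else - 1) x) \<in> range Q"
      using \<open>s \<noteq> s'\<close> by simp
    from indep[OF _ _ this, of s] show False using * by simp
  qed
  define rep where "rep = inv_into S cl"
  have rep: "rep (cl s) = s" if "s \<in> S" for s
    using that inj by (simp add: rep_def)
  have "homogeneous_basis (cl ` S)"
    unfolding homogeneous_basis_def
  proof (intro conjI ballI allI impI)
    show sub: "cl ` S \<subseteq> cohomology"
      using S(1) by (auto simp: cohomology_def cl_def intro!: quotientI)
    have comb: "class_comb (cl ` A) c = cl (\<Sum>s\<in>A. scale (c (cl s)) s)"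
      if "finite A" "A \<subseteq> S" for A c
    proof -
      have "class_comb (cl ` A) c = cl (\<Sum>X\<in>cl ` A. scale (c X) (rep X))"
        unfolding cl_def[of "sum _ _"]
        using that sub self S rep by (intro class_comb_eq) auto
      also have "(\<Sum>X\<in>cl ` A. scale (c X) (rep X)) = (\<Sum>s\<in>A. scale (c (cl s)) s)"
        using that rep by (subst sum.reindex) (auto intro: inj_on_subset[OF inj] intro!: sum.cong)
      finally show ?thesis .
    qed
    show "\<exists>j. X \<inter> gr j \<noteq> {}" if "X \<in> cl ` S" for X
      using that S self by blast
    show "c X = 0" if A: "finite A \<and> A \<subseteq> cl ` S \<and> class_comb A c = cohomologous `` {0}"
      and X: "X \<in> A" for A c X
    proof -
      obtain A' where A': "A' \<subseteq> S" "finite A'" "A = cl ` A'"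
        using A by (metis finite_subset_image)
      have "cl (\<Sum>s\<in>A'. scale (c (cl s)) s) = range Q"
        using A comb[OF A'(2,1), of c] A'(3) zero_class by simp
      moreover have "Q (\<Sum>s\<in>A'. scale (c (cl s)) s) = 0"
        using A'(1) S(1) by (auto simp: Q_sum Q_scale intro!: sum.neutral)
      ultimately have "(\<Sum>s\<in>A'. scale (c (cl s)) s) \<in> range Q" using self by blast
      from indep[OF A'(2,1) this] X A'(3) show ?thesis by blast
    qed
    show "\<exists>A c. finite A \<and> A \<subseteq> cl ` S \<and> Y = class_comb A c" if Y: "Y \<in> cohomology" for Y
    proof -
      obtain y where y: "Q y = 0" "Y = cl y"
        using Y by (auto simp: cohomology_def quotient_def cl_def)
      have "component y j \<in> span C" for j
        using Q_component[OF y(1)] component_spec(1) C(4) by blast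
      then have "y \<in> span C"
        by (subst component_spec(3)) (intro span_sum)
      also have "C = S \<union> I" using C(1) by (auto simp: S_def)
      finally obtain a b where ab: "y = a + b" "a \<in> span S" "b \<in> span I"
        unfolding span_Un by auto
      have b: "b \<in> range Q"
        using ab(3) span_minimal[OF I(1) subspace_range_Q] by blast
      obtain A c where A: "finite A" "A \<subseteq> S" "a = (\<Sum>s\<in>A. scale (c s) s)"
        using ab(2) unfolding span_explicit by auto
      have "class_comb (cl ` A) (c \<circ> rep) = cl (\<Sum>s\<in>A. scale (c (rep (cl s))) s)"
        using comb[OF A(1,2)] by simp
      also have "(\<Sum>s\<in>A. scale (c (rep (cl s))) s) = a"
        unfolding A(3) using A(2) rep by (intro sum.cong) auto
      also have "cl a = Y"
      proof -
        have "Q b = 0" using b Q_square by auto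
        then have Qa: "Q a = 0" using y(1) ab(1) by (simp add: Q_add)
        have "y \<in> cl a" using b by (simp add: cl[OF Qa] ab(1))
        moreover have "cl a \<in> cohomology" using Qa by (auto simp: cohomology_def cl_def intro!: quotientI)
        ultimately show ?thesis using cohomology_class(2) y(2) cl_def by metis
      qed
      finally have "Y = class_comb (cl ` A) (c \<circ> rep)" by (rule sym)
      with A show ?thesis by blast
    qed
  qed
  then show ?thesis ..
qed

section \<open>The equivalence\<close>

text \<open>
  The linear part of the master equation says that \<open>\<Gamma>\<close> lifts the basis classes; combinations of
  these lifts and of \<open>K\<close>-coboundaries then lift every cocycle.
\<close>

lemma quantum_smooth_formal_imp_cocycles_lift:
  assumes quantum_smooth_formal
  shows cocycles_lift
  unfolding cocycles_lift_def
proof (intro allI impI)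
  from assms obtain B r \<Gamma> where B: "homogeneous_basis B" and r: "linear_order_on B r"
    and \<Gamma>: "versal_solution B r \<Gamma>"
    by (auto simp: quantum_smooth_formal_def)
  interpret coordinates scale gr one Q \<Delta> B r by unfold_locales (rule r)
  have K\<Gamma>: "K (\<Gamma> {#X#}) = 0" for X
  proof -
    have "master_defect \<Gamma> {#X#} = 0"
      using \<Gamma> quantum_master_equation_iff[of \<Gamma>] by (simp add: versal_solution_def even_series_iff)
    moreover have "bracket \<Gamma> {#X#} = 0"
      using \<Gamma> vanishes_below_bracket[of \<Gamma>] unfolding vanishes_below_1
      by (simp add: versal_solution_def vanishes_below_def)
    ultimately show ?thesis by (simp add: master_defect_def fps_eq_iff)
  qed
  fix v assume v: "Q v = 0"
  then have "cohomologous `` {v} \<in> cohomology" by (auto simp: cohomology_def intro!: quotientI)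
  then obtain A c where A: "finite A" "A \<subseteq> B" "cohomologous `` {v} = class_comb A c"
    using homogeneous_basisD(4)[OF B] by meson
  have "class_comb A c = cohomologous `` {\<Sum>X\<in>A. scale (c X) (\<Gamma> {#X#} $ 0)}"
    using A homogeneous_basisD(1)[OF B] \<Gamma> by (intro class_comb_eq) (auto simp: versal_solution_def)
  moreover have "v \<in> class_comb A c"
    using A(3) v subspace_0[OF subspace_range_Q] by (simp add: cohomologous_Image flip: A(3))
  moreover have "Q (\<Sum>X\<in>A. scale (c X) (\<Gamma> {#X#} $ 0)) = 0"
  proof -
    have "Q (\<Gamma> {#X#} $ 0) = 0" for X
      using arg_cong[OF K\<Gamma>[of X], of "\<lambda>x. x $ 0"] by simp
    then show ?thesis by (simp add: Q_sum Q_scale)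
  qed
  ultimately have "v - (\<Sum>X\<in>A. scale (c X) (\<Gamma> {#X#} $ 0)) \<in> range Q"
    by (simp add: cohomologous_Image)
  then obtain u where u: "v - (\<Sum>X\<in>A. scale (c X) (\<Gamma> {#X#} $ 0)) = Q u" by blast
  let ?x = "(\<Sum>X\<in>A. hscale (c X) (\<Gamma> {#X#})) + K (fps_const u)"
  have "?x $ 0 = v" using u by (simp add: fps_sum_nth algebra_simps)
  moreover have "K ?x = 0" by (simp add: K_add K_sum K_hscale K\<Gamma> K_square additive.zero[OF additive_hscale])
  ultimately show "\<exists>x. x $ 0 = v \<and> K x = 0" by blast
qed

text \<open>
  The lift of a homogeneous representative may be taken of definite parity, because \<open>K\<close> reverses
  parity; this makes the linear part of the series even.
\<close>

lemma cocycles_lift_imp_quantum_smooth_formal: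
  assumes lift: cocycles_lift
  shows quantum_smooth_formal
proof -
  obtain B where B: "homogeneous_basis B" using homogeneous_basis_exists ..
  obtain r where "well_order_on B r" using well_order_on ..
  then have r: "linear_order_on B r" by (simp add: well_order_on_def)
  interpret coordinates scale gr one Q \<Delta> B r by unfold_locales (rule r)
  have "\<exists>x. x $ 0 \<in> X \<and> (\<exists>j. x $ 0 \<in> gr j) \<and> K x = 0 \<and> has_hbar_parity (mdegree {#X#}) x" if X: "X \<in> B" for X
  proof -
    obtain v j where v: "v \<in> X" "v \<in> gr j" using homogeneous_basisD(2)[OF B] X by blast
    have "Q v = 0" using cohomology_class(1)[of X v] homogeneous_basisD(1)[OF B] X v(1) by blast
    then obtain x where x: "x $ 0 = v" "K x = 0" using lift by (auto simp: cocycles_lift_def)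
    obtain a b where ab: "K a = 0" "has_hbar_parity (mdegree {#X#}) a" "has_hbar_parity (mdegree {#X#} + 1) b" "x = a + b"
      using hbar_parity_primitive[OF x(2), of "mdegree {#X#}"] by auto
    have "has_parity (mdegree {#X#}) (v - a $ 0)"
      using basis_class_parity[OF B X v] ab(2) by (simp add: has_hbar_parity_def has_parity_diff)
    moreover have "v - a $ 0 = b $ 0" using x(1) ab(4) by auto
    ultimately have "v - a $ 0 = 0"
      using ab(3) has_parity_both_eq_0[of "mdegree {#X#}" "b $ 0"] by (simp add: has_hbar_parity_def)
    then have "a $ 0 = v" by simp
    with v ab show ?thesis by blast
  qed
  then obtain \<gamma> where \<gamma>: "\<And>X. X \<in> B \<Longrightarrow> \<gamma> X $ 0 \<in> X \<and> (\<exists>j. \<gamma> X $ 0 \<in> gr j)"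
    "\<And>X. X \<in> B \<Longrightarrow> K (\<gamma> X) = 0" "\<And>X. X \<in> B \<Longrightarrow> has_hbar_parity (mdegree {#X#}) (\<gamma> X)"
    by metis
  obtain \<Gamma> where "\<Gamma> \<in> series B" "has_total_parity 0 \<Gamma>" "\<Gamma> {#} = 0" "\<And>m. master_defect \<Gamma> m = 0"
    "\<And>X. X \<in> B \<Longrightarrow> \<Gamma> {#X#} = \<gamma> X"
    using versal_series_exists[OF lift \<gamma>(2,3)] by blast
  then have "versal_solution B r \<Gamma>"
    using \<gamma>(1) by (simp add: versal_solution_def even_series_iff quantum_master_equation_iff)
  with B r show ?thesis unfolding quantum_smooth_formal_def by blast
qed

end

theorem theorem2:
  fixes scale :: "'k::field_char_0 \<Rightarrow> 'v::ring \<Rightarrow> 'v"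
    and gr :: "int \<Rightarrow> 'v set"
    and one :: 'v
    and Q \<Delta> :: "'v \<Rightarrow> 'v"
  assumes "differential_BV_algebra scale gr one Q \<Delta>"
  shows "differential_BV_algebra.quantum_smooth_formal scale gr Q \<Delta> \<longleftrightarrow>
    degenerates_at_E1 hbar_filtration (differential_BV_algebra.K Q \<Delta>)"
proof -
  interpret differential_BV_algebra scale gr one Q \<Delta> by (rule assms)
  show ?thesis
    using quantum_smooth_formal_imp_cocycles_lift cocycles_lift_imp_quantum_smooth_formal
      cocycles_lift_imp_degenerates degenerates_imp_cocycles_lift by blast
qed

end
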